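(* There exists an efficient (polynomial-time) algorithm that, given a two-player graphical game $G$ with (nonempty) edge set $E\subseteq X\times Y$, produces a biregular two-player game $G_{int}$ with question sets $X_{int}$ and $Y_{int}$ bounded by $$|X_{int}|\le|E|\cdot|X|\le|X|^2|Y|,\qquad |Y_{int}|\le|E|\cdot|Y|\le|X||Y|^2,$$ with the same answer alphabet size as $G$, and whose values satisfy $$\mathrm{Val}(G)=\mathrm{Val}(G_{int}),\qquad \mathrm{Val}^*(G)=\mathrm{Val}^*(G_{int}).$$
   Context: A two-player game $G=(X\times Y,A\times B,\mu,V)$ consists of finite question sets $X,Y$, finite answer sets $A,B$, a probability distribution $\mu$ on $X\times Y$, and a predicate $V:A\times B\times X\times Y\to\{0,1\}$. $G$ is biregular if the marginals of $\mu$ on $X$ and on $Y$ are both uniform. $G$ is graphical with edge set $E\subseteq X\times Y$ if $\mu(x,y)=\frac1{|E|}$ for $(x,y)\in E$ and $\mu(x,y)=0$ otherwise (no restriction on answers or predicate). $\mathrm{Val}(G)$ is the supremum of $\mathbb E_{(x,y)\sim\mu}\sum_{a,b}V(a,b,x,y)f(x,a)g(y,b)$ over $f:X\times A\to[0,1]$, $g:Y\times B\to[0,1]$ with $\sum_af(x,a)=1$ and $\sum_bg(y,b)=1$ for all $x,y$. $\mathrm{Val}^*(G)$ is the supremum of $\mathbb E_{(x,y)\sim\mu}\sum_{a,b}V(a,b,x,y)\langle\psi|A_x^a\otimes B_y^b|\psi\rangle$ over all integers $d$, unit vectors $|\psi\rangle\in\mathbb C^d\otimes\mathbb C^d$ and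 positive semidefinite $d\times d$ matrices with $\sum_aA_x^a=\mathrm{Id}$, $\sum_bB_y^b=\mathrm{Id}$ for all $x,y$. *)

theory Defs
  imports
    "HOL-Computational_Algebra.Polynomial"
    "Jordan_Normal_Form.Schur_Decomposition"
begin

section \<open>Two-player games\<close>

record ('x, 'y, 'a, 'b) game =
  qX :: "'x set"
  qY :: "'y set"
  ansA :: "'a set"
  ansB :: "'b set"
  mu :: "'x \<Rightarrow> 'y \<Rightarrow> real"
  win :: "'a \<Rightarrow> 'b \<Rightarrow> 'x \<Rightarrow> 'y \<Rightarrow> bool"

definition is_game :: "('x, 'y, 'a, 'b) game \<Rightarrow> bool" where
  "is_game G \<longleftrightarrow>
     finite (qX G) \<and> finite (qY G) \<and> finite (ansA G) \<and> finite (ansB G) \<and>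
     (\<forall>x\<in>qX G. \<forall>y\<in>qY G. 0 \<le> mu G x y) \<and>
     (\<Sum>x\<in>qX G. \<Sum>y\<in>qY G. mu G x y) = 1"

definition biregular :: "('x, 'y, 'a, 'b) game \<Rightarrow> bool" where
  "biregular G \<longleftrightarrow>
     (\<forall>x\<in>qX G. (\<Sum>y\<in>qY G. mu G x y) = 1 / real (card (qX G))) \<and>
     (\<forall>y\<in>qY G. (\<Sum>x\<in>qX G. mu G x y) = 1 / real (card (qY G)))"

definition graphical :: "('x, 'y, 'a, 'b) game \<Rightarrow> ('x \<times> 'y) set \<Rightarrow> bool" where
  "graphical G E \<longleftrightarrow>
     E \<subseteq> qX G \<times> qY G \<and>
     (\<forall>x\<in>qX G. \<forall>y\<in>qY G. mu G x y = (if (x, y) \<in> E then 1 / real (card E) else 0))"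

definition strategy :: "'q set \<Rightarrow> 'a set \<Rightarrow> ('q \<Rightarrow> 'a \<Rightarrow> real) \<Rightarrow> bool" where
  "strategy Q A f \<longleftrightarrow>
     (\<forall>q\<in>Q. (\<forall>a\<in>A. 0 \<le> f q a \<and> f q a \<le> 1) \<and> (\<Sum>a\<in>A. f q a) = 1)"

definition Val :: "('x, 'y, 'a, 'b) game \<Rightarrow> real" where
  "Val G = Sup {\<Sum>x\<in>qX G. \<Sum>y\<in>qY G. mu G x y *
                  (\<Sum>a\<in>ansA G. \<Sum>b\<in>ansB G. of_bool (win G a b x y) * f x a * g y b) | f g.
                strategy (qX G) (ansA G) f \<and> strategy (qY G) (ansB G) g}"

definition psd :: "complex mat \<Rightarrow> bool" where
  "psd M \<longleftrightarrow> mat_adjoint M = M \<and>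
     (\<forall>v\<in>carrier_vec (dim_row M). 0 \<le> Re ((M *\<^sub>v v) \<bullet>c v))"

text \<open>Kronecker product; the basis vector \<open>e\<^sub>i \<otimes> e\<^sub>k\<close> has index \<open>i * n + k\<close>, where \<open>n\<close> is the
  dimension of the second factor.\<close>

definition kron :: "complex mat \<Rightarrow> complex mat \<Rightarrow> complex mat" where
  "kron M N = mat (dim_row M * dim_row N) (dim_col M * dim_col N)
     (\<lambda>(r, c). M $$ (r div dim_row N, c div dim_col N) * N $$ (r mod dim_row N, c mod dim_col N))"

text \<open>A family of POVMs, one for each question. The sum condition is stated entrywise because the
  type of matrices of all dimensions has no global zero.\<close>

definition povms :: "nat \<Rightarrow> 'q set \<Rightarrow> 'a set \<Rightarrow> ('q \<Rightarrow> 'a \<Rightarrow> complex mat) \<Rightarrow> bool" where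
  "povms d Q A P \<longleftrightarrow>
     (\<forall>q\<in>Q. (\<forall>a\<in>A. P q a \<in> carrier_mat d d \<and> psd (P q a)) \<and>
             mat d d (\<lambda>ij. \<Sum>a\<in>A. P q a $$ ij) = 1\<^sub>m d)"

text \<open>Since \<open>u \<bullet>c v\<close> conjugates its second argument, \<open>(M *\<^sub>v \<psi>) \<bullet>c \<psi>\<close> is \<open>\<langle>\<psi>|M|\<psi>\<rangle>\<close>; it is real for
  the positive semidefinite \<open>M\<close> occurring here.\<close>

definition Val_star :: "('x, 'y, 'a, 'b) game \<Rightarrow> real" where
  "Val_star G = Sup {\<Sum>x\<in>qX G. \<Sum>y\<in>qY G. mu G x y *
                       (\<Sum>a\<in>ansA G. \<Sum>b\<in>ansB G. of_bool (win G a b x y) *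
                          Re ((kron (P x a) (R y b) *\<^sub>v \<psi>) \<bullet>c \<psi>)) | d \<psi> P R.
                     \<psi> \<in> carrier_vec (d * d) \<and> \<psi> \<bullet>c \<psi> = 1 \<and>
                     povms d (qX G) (ansA G) P \<and> povms d (qY G) (ansB G) R}"

section \<open>Polynomial-time computation\<close>

text \<open>Programs over finitely many stacks of bits (the head of a list is the top of the stack).
  A Turing tape is a pair of stacks, and conversely each stack fits on one tape; every primitive
  step touches a single top symbol and costs one unit, so running times agree with those of
  multi-tape Turing machines up to a constant factor.\<close>

datatype test = Nonempty nat | Top nat

datatype com =
    Skip
  | Push nat bool
  | Pop nat
  | Seq com com
  | Cond test com com
  | While test com

type_synonym state = "nat \<Rightarrow> bool list"

fun holds :: "test \<Rightarrow> state \<Rightarrow> bool" where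
  "holds (Nonempty i) s \<longleftrightarrow> s i \<noteq> []"
| "holds (Top i) s \<longleftrightarrow> s i \<noteq> [] \<and> hd (s i)"

text \<open>\<open>exec c s t s'\<close>: started in \<open>s\<close>, the program \<open>c\<close> halts in \<open>s'\<close> after \<open>t\<close> steps. Popping an
  empty stack leaves it empty.\<close>

inductive exec :: "com \<Rightarrow> state \<Rightarrow> nat \<Rightarrow> state \<Rightarrow> bool" where
  Skip: "exec Skip s 1 s"
| Push: "exec (Push i b) s 1 (s(i := b # s i))"
| Pop: "exec (Pop i) s 1 (s(i := tl (s i)))"
| Seq: "exec c s t s' \<Longrightarrow> exec d s' t' s'' \<Longrightarrow> exec (Seq c d) s (t + t') s''"
| CondTrue: "holds e s \<Longrightarrow> exec c s t s' \<Longrightarrow> exec (Cond e c d) s (t + 1) s'"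
| CondFalse: "\<not> holds e s \<Longrightarrow> exec d s t s' \<Longrightarrow> exec (Cond e c d) s (t + 1) s'"
| WhileFalse: "\<not> holds e s \<Longrightarrow> exec (While e c) s 1 s"
| WhileTrue: "holds e s \<Longrightarrow> exec c s t s' \<Longrightarrow> exec (While e c) s' t' s'' \<Longrightarrow>
    exec (While e c) s (t + t' + 1) s''"

text \<open>Input on stack 0, with all other stacks empty; output on stack 1.\<close>

definition computes :: "com \<Rightarrow> bool list \<Rightarrow> nat \<Rightarrow> bool list \<Rightarrow> bool" where
  "computes c w t w' \<longleftrightarrow> (\<exists>s'. exec c ((\<lambda>_. [])(0 := w)) t s' \<and> s' 1 = w')"

section \<open>Encoding of games\<close>

text \<open>Binary digits, least significant first.\<close>

fun bin :: "nat \<Rightarrow> bool list" where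
  "bin n = (if n = 0 then [] else odd n # bin (n div 2))"

declare bin.simps [simp del]

text \<open>Self-delimiting: every digit is preceded by \<open>True\<close>, and \<open>False\<close> ends the number.\<close>

definition enc_nat :: "nat \<Rightarrow> bool list" where
  "enc_nat n = concat (map (\<lambda>b. [True, b]) (bin n)) @ [False]"

definition tally :: "nat \<Rightarrow> bool list" where
  "tally n = replicate n True @ [False]"

text \<open>\<open>w\<close> describes \<open>G\<close> with respect to some listing of its question and answer sets: the sizes of
  the sets (one mark per element), then the table of the probabilities as fractions of binary
  numbers, then the truth table of the predicate. Only games with rational probabilities have a
  description. Fractions need not be in lowest terms.\<close>

definition encodes :: "bool list \<Rightarrow> ('x, 'y, 'a, 'b) game \<Rightarrow> bool" where
  "encodes w G \<longleftrightarrow> (\<exists>xs ys as bs (p :: 'x \<Rightarrow> 'y \<Rightarrow> nat) (q :: 'x \<Rightarrow> 'y \<Rightarrow> nat).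
     distinct xs \<and> set xs = qX G \<and> distinct ys \<and> set ys = qY G \<and>
     distinct as \<and> set as = ansA G \<and> distinct bs \<and> set bs = ansB G \<and>
     (\<forall>x\<in>qX G. \<forall>y\<in>qY G. 0 < q x y \<and> mu G x y = real (p x y) / real (q x y)) \<and>
     w = tally (length xs) @ tally (length ys) @ tally (length as) @ tally (length bs) @
         concat [enc_nat (p x y) @ enc_nat (q x y). x \<leftarrow> xs, y \<leftarrow> ys] @
         [win G a b x y. x \<leftarrow> xs, y \<leftarrow> ys, a \<leftarrow> as, b \<leftarrow> bs])"

end

theory Submission
  imports Defs
begin

text \<open>Split every question \<open>x\<close> into \<open>deg x\<close> copies and every \<open>y\<close> into \<open>deg y\<close> copies, where \<open>deg\<close> is the
  degree in the bipartite graph \<open>E\<close>, and distribute \<open>\<mu>(x, y)\<close> evenly over the pairs of copies. A copy of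
  \<open>x\<close> then has probability \<open>(deg x / |E|) / deg x = 1 / |E|\<close>, so the new game is biregular, with \<open>|E|\<close>
  questions on each side. Given \<open>(x, y)\<close> the two copies are independent and uniform, so by bilinearity a
  strategy of the new game has the same value as the strategy of \<open>G\<close> that averages it over the copies of
  each question; conversely a strategy of \<open>G\<close> is used on all copies. Hence the sets of attainable
  values coincide, both classically and for POVMs of a fixed dimension.

  The copies of the questions of both players are indexed by the edges, listed in row-major order: edge
  number \<open>k\<close> stands for a copy of its left end for one player and of its right end for the other.\<close>

section \<open>Running times of stack programs\<close>

text \<open>The copies of \<open>x\<close> need no numbering of their own: exactly deg x edges have
  left end \<open>x\<close>, so the left ends of the listed edges run through each \<open>x\<close>
  the right number of times, and the right ends do the same for \<open>y\<close>. One loop over the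
  edges thus enumerates either question set, and a question pair is two edges chosen without regard
  to each other: the left end of the first and the right end of the second may be nonadjacent, and
  then the pair has probability zero. What shapes the rest is the machine, which has neither
  arithmetic nor indexing. Sizes arrive in unary, so products come from nested loops, and table
  lookup from skipping a counted number of bits. The denominator |E| deg x deg y of a pair of copies
  is counted in unary, then converted to binary, and the fraction is left unreduced. This stays
  polynomial because the input spells out all set sizes in unary and the whole truth table, so its
  length bounds every loop. The input probabilities matter only through being zero or not.\<close>

definition runs :: "com \<Rightarrow> state \<Rightarrow> nat \<Rightarrow> state \<Rightarrow> bool" where
  "runs c s T s' \<longleftrightarrow> (\<exists>t\<le>T. exec c s t s')"

lemma runs_mono: "runs c s T s' \<Longrightarrow> T \<le> T' \<Longrightarrow> runs c s T' s'"
  unfolding runs_def by (meson order.trans)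

lemma runs_weaken: "runs c s T s' \<Longrightarrow> T \<le> T' \<Longrightarrow> s' = s'' \<Longrightarrow> runs c s T' s''"
  using runs_mono by blast

lemma runs_Push: "runs (Push i b) s 1 (s(i := b # s i))"
  unfolding runs_def using exec.Push by blast

lemma runs_Pop: "runs (Pop i) s 1 (s(i := tl (s i)))"
  unfolding runs_def using exec.Pop by blast

lemma runs_Seq: "runs c s T s' \<Longrightarrow> runs d s' T' s'' \<Longrightarrow> runs (Seq c d) s (T + T') s''"
  unfolding runs_def by (meson exec.Seq add_mono)

text \<open>Since \<open>runs\<close> keeps only an upper bound on the time, branches of different
  length can share one \<open>T\<close>.\<close>

lemma runs_Cond:
  assumes "holds e s \<Longrightarrow> runs c s T s'" "\<not> holds e s \<Longrightarrow> runs d s T s'"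
  shows "runs (Cond e c d) s (T + 1) s'"
proof (cases "holds e s")
  case True
  then show ?thesis
    using assms(1) exec.CondTrue[OF True] unfolding runs_def by (meson add_le_mono1)
next
  case False
  then show ?thesis
    using assms(2) exec.CondFalse[OF False] unfolding runs_def by (meson add_le_mono1)
qed

text \<open>The invariant is the explicit sequence \<open>S\<close> of states between rounds, so a
  loop is verified by checking a single round. Each round pays one unit for its test, and the
  failing test adds the last one.\<close>

lemma runs_While:
  assumes "\<And>i. i < n \<Longrightarrow> holds e (S i)"
    and "\<And>i. i < n \<Longrightarrow> runs c (S i) T (S (Suc i))"
    and "\<not> holds e (S n)"
  shows "runs (While e c) (S 0) (n * (T + 1) + 1) (S n)"
  using assms
proof (induction n arbitrary: S)
  case 0
  then show ?case
    unfolding runs_def using exec.WhileFalse by auto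
next
  case (Suc n)
  have *: "runs (While e c) (S (Suc 0)) (n * (T + 1) + 1) (S (Suc n))"
    using Suc.IH[of "\<lambda>i. S (Suc i)"] Suc.prems by simp
  have "holds e (S 0)" "runs c (S 0) T (S (Suc 0))"
    using Suc.prems by simp_all
  then obtain t t' where t: "t \<le> T" "exec c (S 0) t (S (Suc 0))"
    "t' \<le> n * (T + 1) + 1" "exec (While e c) (S (Suc 0)) t' (S (Suc n))"
    using * unfolding runs_def by auto
  have "exec (While e c) (S 0) (t + t' + 1) (S (Suc n))"
    using exec.WhileTrue[OF \<open>holds e (S 0)\<close> t(2,4)] .
  moreover have "t + t' + 1 \<le> Suc n * (T + 1) + 1"
    using t by simp
  ultimately show ?case
    unfolding runs_def by blast
qed

definition Move :: "nat \<Rightarrow> nat \<Rightarrow> com" where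
  "Move i j = Seq (Cond (Top i) (Push j True) (Push j False)) (Pop i)"

lemma runs_copy_top:
  assumes "s i = b # l"
  shows "runs (Cond (Top i) (Push j True) (Push j False)) s 2 (s(j := b # s j))"
  using runs_Cond[of "Top i" s "Push j True" 1 "s(j := b # s j)" "Push j False"]
    runs_Push[of j True s] runs_Push[of j False s] assms by (auto simp: numeral_2_eq_2)

lemma runs_Move:
  assumes "s i = b # l" "i \<noteq> j"
  shows "runs (Move i j) s 3 (s(i := l, j := b # s j))"
proof -
  have "runs (Move i j) s (2 + 1) ((s(j := b # s j))(i := tl ((s(j := b # s j)) i)))"
    unfolding Move_def by (rule runs_Seq[OF runs_copy_top[where s = s, OF assms(1)] runs_Pop])
  then show ?thesis
    by (rule runs_weaken) (use assms in \<open>auto simp: fun_upd_twist\<close>)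
qed

lemma runs_pour:
  assumes "i \<noteq> j"
  shows "runs (While (Nonempty i) (Move i j)) s (4 * length (s i) + 1)
           (s(i := [], j := rev (s i) @ s j))"
proof -
  let ?S = "\<lambda>k. s(i := drop k (s i), j := rev (take k (s i)) @ s j)"
  have "runs (While (Nonempty i) (Move i j)) (?S 0) (length (s i) * (3 + 1) + 1) (?S (length (s i)))"
  proof (rule runs_While)
    fix k assume k: "k < length (s i)"
    then have d: "drop k (s i) = s i ! k # drop (Suc k) (s i)"
      by (simp add: Cons_nth_drop_Suc)
    show "holds (Nonempty i) (?S k)"
      using k assms by simp
    have "?S k i = s i ! k # drop (Suc k) (s i)" using assms d by simp
    from runs_Move[where s = "?S k", OF this assms]
    show "runs (Move i j) (?S k) 3 (?S (Suc k))"
      by (rule runs_weaken) (use assms k in \<open>auto simp: take_Suc_conv_app_nth fun_eq_iff\<close>)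
  qed (use assms in simp)
  then show ?thesis
    by (auto elim!: runs_weaken)
qed

text \<open>Code with this property appends \<open>l\<close> to the output that is accumulated in reverse on stack \<open>k\<close>, and
  it may use the other stacks as long as it restores them.\<close>

definition emits :: "nat \<Rightarrow> com \<Rightarrow> nat \<Rightarrow> state \<Rightarrow> bool list \<Rightarrow> bool" where
  "emits k c T s l \<longleftrightarrow> (\<forall>z. runs c (s(k := z)) T (s(k := rev l @ z)))"

lemma emits_mono: "emits k c T s l \<Longrightarrow> T \<le> T' \<Longrightarrow> l = l' \<Longrightarrow> emits k c T' s l'"
  unfolding emits_def using runs_mono by blast

lemma emits_Push: "emits k (Push k b) 1 s [b]"
  unfolding emits_def using runs_Push[of k b "s(k := _)"] by simp

text \<open>Both parts are judged in the same \<open>s\<close>, because emitting code changes no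
  stack but \<open>k\<close>.\<close>

lemma emits_Seq:
  "emits k c T s l \<Longrightarrow> emits k d T' s l' \<Longrightarrow> emits k (Seq c d) (T + T') s (l @ l')"
  unfolding emits_def by (auto intro: runs_Seq)

lemma emitsD: "emits k c T s l \<Longrightarrow> runs c s T (s(k := rev l @ s k))"
  unfolding emits_def by (metis fun_upd_triv)

text \<open>The stacks \<open>r\<close> and \<open>h\<close> hold the remaining and the completed iterations in unary, so that \<open>h\<close> is the
  loop index inside the body. The second loop restores \<open>r\<close>.\<close>

definition For :: "nat \<Rightarrow> nat \<Rightarrow> com \<Rightarrow> com" where
  "For r h c = Seq (While (Nonempty r) (Seq c (Seq (Pop r) (Push h True))))
                   (While (Nonempty h) (Seq (Pop h) (Push r True)))"

text \<open>Per round: \<open>B\<close> for the body, 3 for moving the mark and testing, and 3 more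
  in the restoring loop. The final 2 pays for the two failing tests.\<close>

definition for_cost :: "nat \<Rightarrow> nat \<Rightarrow> nat" where
  "for_cost Z B = Z * (B + 6) + 2"

lemma emits_For:
  assumes dist: "r \<noteq> h" "k \<noteq> r" "k \<noteq> h"
    and r: "s r = replicate n True" and h: "s h = []" and n: "n \<le> N"
    and body: "\<And>i. i < n \<Longrightarrow>
      emits k c T (s(h := replicate i True, r := replicate (n - i) True)) (f i)"
  shows "emits k (For r h c) (for_cost N T) s (concat (map f [0..<n]))"
  unfolding emits_def for_cost_def
proof
  fix z
  let ?out = "\<lambda>i. rev (concat (map f [0..<i])) @ z"
  let ?S = "\<lambda>i. s(h := replicate i True, r := replicate (n - i) True, k := ?out i)"
  let ?S' = "\<lambda>i. s(h := replicate (n - i) True, r := replicate i True, k := ?out n)"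
  have 1: "runs (While (Nonempty r) (Seq c (Seq (Pop r) (Push h True))))
    (?S 0) (n * (T + (1 + 1) + 1) + 1) (?S n)"
  proof (rule runs_While)
    fix i assume i: "i < n"
    show "holds (Nonempty r) (?S i)"
      using i dist by simp
    have "runs c (?S i) T (s(h := replicate i True, r := replicate (n - i) True, k := rev (f i) @ ?out i))"
      using body[OF i] unfolding emits_def by blast
    from runs_Seq[OF this runs_Seq[OF runs_Pop[of r] runs_Push[of h True]]]
    show "runs (Seq c (Seq (Pop r) (Push h True))) (?S i) (T + (1 + 1)) (?S (Suc i))"
    proof (rule runs_weaken)
      have "n - i = Suc (n - Suc i)"
        using i by simp
      then show "(s(h := replicate i True, r := replicate (n - i) True, k := rev (f i) @ ?out i,
          r := tl ((s(h := replicate i True, r := replicate (n - i) True, k := rev (f i) @ ?out i)) r),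
          h := True # (s(h := replicate i True, r := replicate (n - i) True, k := rev (f i) @ ?out i,
          r := tl ((s(h := replicate i True, r := replicate (n - i) True, k := rev (f i) @ ?out i)) r))) h))
        = ?S (Suc i)"
        using dist by (auto simp: fun_eq_iff)
    qed simp
  qed (use dist in simp)
  have 2: "runs (While (Nonempty h) (Seq (Pop h) (Push r True))) (?S' 0) (n * (1 + 1 + 1) + 1) (?S' n)"
  proof (rule runs_While)
    fix i assume i: "i < n"
    show "holds (Nonempty h) (?S' i)"
      using i dist by simp
    have "n - i = Suc (n - Suc i)"
      using i by simp
    then show "runs (Seq (Pop h) (Push r True)) (?S' i) (1 + 1) (?S' (Suc i))"
      by (intro runs_weaken[OF runs_Seq[OF runs_Pop runs_Push]]) (use dist in \<open>auto simp: fun_eq_iff\<close>)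
  qed (use dist in simp)
  have eqs: "?S' 0 = ?S n" "?S 0 = s(k := z)" "?S' n = s(k := ?out n)"
    using dist r h by (auto simp: fun_eq_iff)
  have "runs (For r h c) (s(k := z)) (n * (T + (1 + 1) + 1) + 1 + (n * (1 + 1 + 1) + 1)) (s(k := ?out n))"
    using runs_Seq[OF 1 2[unfolded eqs(1)]] unfolding For_def eqs .
  moreover have "n * (T + (1 + 1) + 1) + 1 + (n * (1 + 1 + 1) + 1) \<le> N * (T + 6) + 2"
    using mult_le_mono1[OF n, of "T + 6"] by (simp add: algebra_simps)
  ultimately show "runs (For r h c) (s(k := z)) (N * (T + 6) + 2) (s(k := ?out n))"
    by (rule runs_mono)
qed

section \<open>Table lookup and binary counters\<close>

text \<open>Stack layout. 0: input, later the truth table of the predicate; 1: output; 2: table of \<open>E\<close>;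
  3: reversed output; 4: unary counter; 5: scratch, holds the part of a table that has been passed over;
  6: bit that was read from table 2; 7: unary table offset; 8: binary counter; 9: scratch for the binary
  counter; 10 to 31: pairs \<open>r\<close>, \<open>r + 1\<close> of loop stacks as in \<open>For\<close>, where 26 is bounded by \<open>|Y|\<close>, 28 by \<open>|A|\<close>
  and 30 by \<open>|B|\<close>; 32: scratch for loops over a loop index.\<close>

text \<open>Appends entry \<open>(i, j)\<close> of the table on stack \<open>T\<close> to stack \<open>k\<close>, where \<open>i\<close> and \<open>j\<close> are in unary on \<open>hx\<close> and
  \<open>hy\<close>, and entries consist of as many bits as \<open>c\<close> pushes marks onto stack 7.\<close>

definition Fetch :: "com \<Rightarrow> nat \<Rightarrow> nat \<Rightarrow> nat \<Rightarrow> nat \<Rightarrow> com" where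
  "Fetch c T k hx hy =
     Seq (Seq (For hx 32 (For 26 27 c)) (For hy 32 c))
    (Seq (While (Nonempty 7) (Seq (Pop 7) (Move T 5)))
    (Seq c
    (Seq (While (Nonempty 7)
           (Seq (Pop 7) (Seq (Cond (Top T) (Push k True) (Push k False)) (Move T 5))))
         (While (Nonempty 5) (Move 5 T)))))"

text \<open>A skipped bit costs 5 steps, a copied bit 7 and a restored bit 4, tests included; the
  two leading summands build the offset.\<close>

definition fetch_cost :: "nat \<Rightarrow> nat \<Rightarrow> nat" where
  "fetch_cost Z B = for_cost Z (for_cost Z B) + for_cost Z B +
     ((Z * 5 + 1) + (B + ((Z * 7 + 1) + (4 * Z + 1))))"

lemma concat_replicate_const:
  "concat (map (\<lambda>_. replicate b x) [0..<n]) = replicate (n * b) x"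
  by (induction n) (simp_all add: replicate_add[symmetric] add.commute)

lemma runs_skip:
  assumes u: "u 7 = replicate K True" "u T = tbl" "u 5 = []" "K \<le> length tbl" and T: "T \<noteq> 5" "T \<noteq> 7"
  shows "runs (While (Nonempty 7) (Seq (Pop 7) (Move T 5))) u (K * 5 + 1)
           (u(7 := [], T := drop K tbl, 5 := rev (take K tbl)))"
proof -
  let ?S = "\<lambda>a. u(7 := replicate (K - a) True, T := drop a tbl, 5 := rev (take a tbl))"
  have "runs (While (Nonempty 7) (Seq (Pop 7) (Move T 5))) (?S 0) (K * (1 + 3 + 1) + 1) (?S K)"
  proof (rule runs_While)
    fix a assume a: "a < K"
    show "holds (Nonempty 7) (?S a)"
      using a T by simp
    let ?s = "(?S a)(7 := tl (?S a 7))"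
    have "?s T = tbl ! a # drop (Suc a) tbl"
      using T a u(4) by (simp add: Cons_nth_drop_Suc)
    from runs_Seq[OF runs_Pop runs_Move[where s = ?s, OF this T(1)]]
    show "runs (Seq (Pop 7) (Move T 5)) (?S a) (1 + 3) (?S (Suc a))"
    proof (rule runs_weaken)
      have "K - a = Suc (K - Suc a)" using a by simp
      then show "?s(T := drop (Suc a) tbl, 5 := tbl ! a # ?s 5) = ?S (Suc a)"
        using T a u(4) by (auto simp: fun_eq_iff take_Suc_conv_app_nth)
    qed simp
  qed (use T in simp)
  moreover have "?S 0 = u"
    using u by (auto simp: fun_eq_iff)
  ultimately show ?thesis
    by simp
qed

lemma runs_copy:
  assumes u: "u 7 = replicate b True" "u T = drop K tbl" "u 5 = rev (take K tbl)" "K + b \<le> length tbl"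
    and T: "T \<noteq> 5" "T \<noteq> 7" "T \<noteq> k" "k \<noteq> 5" "k \<noteq> 7"
  shows "runs (While (Nonempty 7)
           (Seq (Pop 7) (Seq (Cond (Top T) (Push k True) (Push k False)) (Move T 5)))) u (b * 7 + 1)
           (u(7 := [], T := drop (K + b) tbl, 5 := rev (take (K + b) tbl),
              k := rev (take b (drop K tbl)) @ u k))"
    (is "runs ?c _ _ _")
proof -
  let ?S = "\<lambda>a. u(7 := replicate (b - a) True, T := drop (K + a) tbl, 5 := rev (take (K + a) tbl),
              k := rev (take a (drop K tbl)) @ u k)"
  have "runs ?c (?S 0) (b * (1 + (2 + 3) + 1) + 1) (?S b)"
  proof (rule runs_While)
    fix a assume a: "a < b"
    show "holds (Nonempty 7) (?S a)"
      using a T by simp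
    let ?s = "(?S a)(7 := tl (?S a 7))"
    have s: "?s T = tbl ! (K + a) # drop (Suc (K + a)) tbl"
      using T a u(4) by (simp add: Cons_nth_drop_Suc)
    then have "(?s(k := tbl ! (K + a) # ?s k)) T = tbl ! (K + a) # drop (Suc (K + a)) tbl"
      using T by simp
    from runs_Seq[OF runs_Pop runs_Seq[OF runs_copy_top[where s = ?s, OF s, of k]
        runs_Move[where s = "?s(k := tbl ! (K + a) # ?s k)", OF this T(1)]]]
    show "runs (Seq (Pop 7) (Seq (Cond (Top T) (Push k True) (Push k False)) (Move T 5)))
            (?S a) (1 + (2 + 3)) (?S (Suc a))"
    proof (rule runs_weaken)
      have "b - a = Suc (b - Suc a)" using a by simp
      moreover have "take (Suc a) (drop K tbl) = take a (drop K tbl) @ [tbl ! (K + a)]"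
        using a u(4) by (simp add: take_Suc_conv_app_nth)
      moreover have "take (Suc (K + a)) tbl = take (K + a) tbl @ [tbl ! (K + a)]"
        using a u(4) by (simp add: take_Suc_conv_app_nth)
      ultimately show "?s(k := tbl ! (K + a) # ?s k, T := drop (Suc (K + a)) tbl,
          5 := tbl ! (K + a) # (?s(k := tbl ! (K + a) # ?s k)) 5) = ?S (Suc a)"
        using T by (auto simp: fun_eq_iff)
    qed simp
  qed (use T in simp)
  moreover have "?S 0 = u"
    using u by (auto simp: fun_eq_iff)
  ultimately show ?thesis
    by simp
qed

text \<open>Multiplication is loop nesting: \<open>i\<close> rounds of \<open>n\<close> calls of
  \<open>c\<close>, then \<open>j\<close> further calls, leave \<open>(i * n + j) * b\<close> marks
  on stack 7. Bits passed over wait on stack 5 and are poured back, so the table survives. The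
  premise on \<open>c\<close> ranges over other states because \<open>c\<close> is called inside
  loops that alter their counters.\<close>

lemma emits_Fetch:
  assumes ix: "s hx = replicate i True" "s hy = replicate j True" "s 26 = replicate n True"
    and empty: "s 5 = []" "s 7 = []" "s 27 = []" "s 32 = []"
    and dist: "hx \<in> {10..<26}" "hy \<in> {10..<26}" "T \<in> {0, 2}" "k \<in> {3, 6}"
    and tbl: "s T = tbl" "(i * n + j + 1) * b \<le> length tbl"
    and Z: "length tbl \<le> Z" "i \<le> Z" "j \<le> Z" "n \<le> Z"
    and c: "\<And>s'. (\<And>q. q \<in> {28..31} \<Longrightarrow> s' q = s q) \<Longrightarrow> emits 7 c B s' (replicate b True)"
  shows "emits k (Fetch c T k hx hy) (fetch_cost Z B) s (take b (drop ((i * n + j) * b) tbl))"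
  unfolding emits_def
proof
  fix z
  define u where "u = s(k := z)"
  define K where "K = (i * n + j) * b"
  have len: "K + b \<le> length tbl"
    using tbl(2) unfolding K_def by (simp add: add.commute)
  have neq: "hx \<noteq> 32" "hx \<noteq> 7" "hx \<noteq> 26" "hx \<noteq> 27" "hx \<noteq> k" "hx \<noteq> 5"
    "hy \<noteq> 32" "hy \<noteq> 7" "hy \<noteq> 26" "hy \<noteq> 27" "hy \<noteq> k" "hy \<noteq> 5"
    "T \<noteq> 5" "T \<noteq> 7" "T \<noteq> k" "k \<noteq> 5" "k \<noteq> 7" "k \<noteq> 26" "k \<noteq> 27" "k \<noteq> 32" "T \<noteq> 32"
    "28 \<le> q \<Longrightarrow> q \<noteq> hx" "28 \<le> q \<Longrightarrow> q \<noteq> hy" "28 \<le> q \<Longrightarrow> q \<noteq> k" for q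
    using dist by auto
  have "emits 7 (For hx 32 (For 26 27 c)) (for_cost Z (for_cost Z B)) u
      (concat (map (\<lambda>_. replicate (n * b) True) [0..<i]))"
  proof (rule emits_For)
    fix a assume "a < i"
    let ?u = "u(32 := replicate a True, hx := replicate (i - a) True)"
    have "emits 7 (For 26 27 c) (for_cost Z B) ?u (concat (map (\<lambda>_. replicate b True) [0..<n]))"
      by (rule emits_For)
        (use ix empty neq Z in \<open>auto simp: u_def intro!: c\<close>)
    then show "emits 7 (For 26 27 c) (for_cost Z B) ?u (replicate (n * b) True)"
      unfolding concat_replicate_const .
  qed (use ix empty neq Z in \<open>auto simp: u_def\<close>)
  moreover have "emits 7 (For hy 32 c) (for_cost Z B) u
      (concat (map (\<lambda>_. replicate b True) [0..<j]))"
    by (rule emits_For) (use ix empty neq Z in \<open>auto simp: u_def intro!: c\<close>)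
  ultimately have "emits 7 (Seq (For hx 32 (For 26 27 c)) (For hy 32 c))
      (for_cost Z (for_cost Z B) + for_cost Z B) u (replicate K True)"
    unfolding concat_replicate_const
    by (intro emits_mono[OF emits_Seq]) (auto simp: K_def replicate_add[symmetric] algebra_simps)
  from emitsD[OF this] have 1: "runs (Seq (For hx 32 (For 26 27 c)) (For hy 32 c)) u
      (for_cost Z (for_cost Z B) + for_cost Z B) (u(7 := replicate K True))"
    using empty neq by (simp add: u_def)
  have 2: "runs (While (Nonempty 7) (Seq (Pop 7) (Move T 5))) (u(7 := replicate K True)) (Z * 5 + 1)
      (u(7 := [], T := drop K tbl, 5 := rev (take K tbl)))"
    by (rule runs_weaken[OF runs_skip[where tbl = tbl and K = K]])
      (use neq len empty tbl Z in \<open>auto simp: u_def\<close>)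
  let ?u1 = "u(7 := [], T := drop K tbl, 5 := rev (take K tbl))"
  have "emits 7 c B ?u1 (replicate b True)"
    by (rule c) (use neq dist in \<open>auto simp: u_def\<close>)
  from emitsD[OF this] have 3: "runs c ?u1 B (?u1(7 := replicate b True))"
    using neq by simp
  let ?out = "rev (take b (drop K tbl)) @ z"
  let ?u2 = "u(7 := [], T := drop (K + b) tbl, 5 := rev (take (K + b) tbl), k := ?out)"
  have 4: "runs (While (Nonempty 7)
      (Seq (Pop 7) (Seq (Cond (Top T) (Push k True) (Push k False)) (Move T 5))))
      (?u1(7 := replicate b True)) (Z * 7 + 1) ?u2"
    by (rule runs_weaken[OF runs_copy[where tbl = tbl and K = K and b = b]])
      (use neq len Z in \<open>auto simp: u_def fun_eq_iff\<close>)
  have 5: "runs (While (Nonempty 5) (Move 5 T)) ?u2 (4 * Z + 1) (s(k := ?out))"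
    by (rule runs_weaken[OF runs_pour])
      (use neq len Z empty tbl in \<open>auto simp: u_def fun_eq_iff\<close>)
  show "runs (Fetch c T k hx hy) (s(k := z)) (fetch_cost Z B)
      (s(k := rev (take b (drop ((i * n + j) * b) tbl)) @ z))"
    using runs_Seq[OF 1 runs_Seq[OF 2 runs_Seq[OF 3 runs_Seq[OF 4 5]]]]
    unfolding Fetch_def fetch_cost_def K_def u_def by simp
qed

text \<open>The bit is removed from stack 6 before \<open>c\<close> starts, so \<open>c\<close> sees
  the original state and tests can be nested.\<close>

definition IfE :: "nat \<Rightarrow> nat \<Rightarrow> com \<Rightarrow> com" where
  "IfE hx hy c = Seq (Fetch (Push 7 True) 2 6 hx hy) (Cond (Top 6) (Seq (Pop 6) c) (Pop 6))"

lemma emits_IfE: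
  assumes ix: "s hx = replicate i True" "s hy = replicate j True" "s 26 = replicate n True"
    and empty: "s 5 = []" "s 6 = []" "s 7 = []" "s 27 = []" "s 32 = []"
    and dist: "hx \<in> {10..<26}" "hy \<in> {10..<26}" "k \<in> {3, 4}"
    and tbl: "s 2 = tbl" "i * n + j < length tbl"
    and Z: "length tbl \<le> Z" "i \<le> Z" "j \<le> Z" "n \<le> Z"
    and c: "tbl ! (i * n + j) \<Longrightarrow> emits k c B s l"
  shows "emits k (IfE hx hy c) (fetch_cost Z 1 + (B + 2)) s (if tbl ! (i * n + j) then l else [])"
  unfolding emits_def
proof
  fix z
  let ?u = "s(k := z)" and ?b = "tbl ! (i * n + j)"
  have "emits 6 (Fetch (Push 7 True) 2 6 hx hy) (fetch_cost Z 1) ?u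
      (take 1 (drop ((i * n + j) * 1) tbl))"
    by (rule emits_Fetch)
      (use assms in \<open>auto intro: emits_mono[OF emits_Push]\<close>)
  from emitsD[OF this] have 1: "runs (Fetch (Push 7 True) 2 6 hx hy) ?u (fetch_cost Z 1) (?u(6 := [?b]))"
    using tbl(2) empty dist by (auto simp: take_Suc hd_drop_conv_nth)
  have 2: "runs (Cond (Top 6) (Seq (Pop 6) c) (Pop 6)) (?u(6 := [?b])) (B + 1 + 1)
      (s(k := rev (if ?b then l else []) @ z))"
  proof (rule runs_Cond)
    have pop: "runs (Pop 6) (?u(6 := [?b])) 1 ?u"
      by (rule runs_weaken[OF runs_Pop]) (use empty dist in \<open>auto simp: fun_eq_iff\<close>)
    show "runs (Seq (Pop 6) c) (?u(6 := [?b])) (B + 1) (s(k := rev (if ?b then l else []) @ z))"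
      if "holds (Top 6) (?u(6 := [?b]))"
      using that c runs_Seq[OF pop] unfolding emits_def by simp
    show "runs (Pop 6) (?u(6 := [?b])) (B + 1) (s(k := rev (if ?b then l else []) @ z))"
      if "\<not> holds (Top 6) (?u(6 := [?b]))"
      using that by (intro runs_weaken[OF pop]) auto
  qed
  show "runs (IfE hx hy c) ?u (fetch_cost Z 1 + (B + 2)) (s(k := rev (if ?b then l else []) @ z))"
    using runs_Seq[OF 1 2] unfolding IfE_def by simp
qed

section \<open>Binary counter and conversion from unary to binary\<close>

lemma bin_0 [simp]: "bin 0 = []"
  by (simp add: bin.simps)

lemma bin_pos: "0 < n \<Longrightarrow> bin n = odd n # bin (n div 2)"
  by (subst bin.simps) simp

text \<open>A logarithmic bound would gain nothing: numbers are produced in unary before they are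
  converted.\<close>

lemma length_bin_le: "length (bin n) \<le> n"
proof (induction n rule: less_induct)
  case (less n)
  show ?case
  proof (cases "n = 0")
    case False
    then show ?thesis
      using less.IH[of "n div 2"] by (simp add: bin_pos)
  qed simp
qed

text \<open>Carry propagation: the initial run of ones is cleared and the digit after it is set. If
  \<open>l = []\<close>, the carry passes the leading digit and the new \<open>True\<close>
  lengthens the number.\<close>

lemma bin_Suc_split:
  "\<exists>k l. bin n = replicate k True @ l \<and> (l = [] \<or> \<not> hd l) \<and>
     bin (Suc n) = replicate k False @ True # tl l"
proof (induction n rule: less_induct)
  case (less n)
  consider "n = 0" | "0 < n" "even n" | "odd n"
    by auto
  then show ?case
  proof cases
    case 1
    then show ?thesis
      by (intro exI[of _ 0] exI[of _ "[]"]) (simp add: bin_pos)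
  next
    case 2
    then show ?thesis
      by (intro exI[of _ 0] exI[of _ "bin n"]) (simp add: bin_pos)
  next
    case 3
    then have "n div 2 < n"
      by (cases n) auto
    from less.IH[OF this] obtain k l where kl: "bin (n div 2) = replicate k True @ l"
      "l = [] \<or> \<not> hd l" "bin (Suc (n div 2)) = replicate k False @ True # tl l"
      by blast
    from 3 have "0 < n" "Suc n div 2 = Suc (n div 2)"
      by (auto elim: oddE)
    with 3 kl show ?thesis
      by (intro exI[of _ "Suc k"] exI[of _ l]) (simp add: bin_pos)
  qed
qed

text \<open>The \<open>Pop\<close> between the loops removes the zero that absorbs the carry; it is
  harmless on an empty stack, where the carry has run past the leading digit.\<close>

definition Inc :: com where
  "Inc = Seq (While (Top 8) (Seq (Pop 8) (Push 9 False)))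
        (Seq (Pop 8) (Seq (Push 8 True) (While (Nonempty 9) (Move 9 8))))"

lemma runs_Inc:
  assumes s: "s 8 = bin n" "s 9 = []"
  shows "runs Inc s (7 * n + 4) (s(8 := bin (Suc n)))"
proof -
  obtain k l where kl: "bin n = replicate k True @ l" "l = [] \<or> \<not> hd l"
    "bin (Suc n) = replicate k False @ True # tl l"
    using bin_Suc_split by blast
  let ?S = "\<lambda>i. s(8 := replicate (k - i) True @ l, 9 := replicate i False)"
  have 1: "runs (While (Top 8) (Seq (Pop 8) (Push 9 False))) (?S 0) (k * (1 + 1 + 1) + 1) (?S k)"
  proof (rule runs_While)
    fix i assume i: "i < k"
    then have "k - i = Suc (k - Suc i)"
      by simp
    then show "holds (Top 8) (?S i)"
      "runs (Seq (Pop 8) (Push 9 False)) (?S i) (1 + 1) (?S (Suc i))"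
      by (auto intro!: runs_weaken[OF runs_Seq[OF runs_Pop runs_Push]] simp: fun_eq_iff)
  qed (use kl in auto)
  have S0: "?S 0 = s"
    using s kl by (auto simp: fun_eq_iff)
  let ?u = "(?S k)(8 := True # tl l)"
  have 2: "runs (Seq (Push 8 True) (While (Nonempty 9) (Move 9 8)))
     ((?S k)(8 := tl (?S k 8))) (1 + (4 * length (?u 9) + 1)) (s(8 := bin (Suc n)))"
  proof (rule runs_Seq)
    show "runs (Push 8 True) ((?S k)(8 := tl (?S k 8))) 1 ?u"
      by (rule runs_weaken[OF runs_Push]) (auto simp: fun_eq_iff)
    show "runs (While (Nonempty 9) (Move 9 8)) ?u (4 * length (?u 9) + 1) (s(8 := bin (Suc n)))"
      by (rule runs_weaken[OF runs_pour]) (use s kl in \<open>auto simp: fun_eq_iff\<close>)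
  qed
  \<comment> \<open>Each of the \<open>k\<close> carried digits costs 3 steps when cleared and 4
    when moved back, hence the factor 7.\<close>
  have "k \<le> n"
    using length_bin_le[of n] kl by simp
  then show ?thesis
    using runs_Seq[OF 1 runs_Seq[OF runs_Pop 2]] unfolding Inc_def S0
    by (elim runs_weaken) auto
qed

text \<open>Repeated increments replace division. The least significant digit lies on top of stack
  8, so popping yields the digits in the order of \<open>bin\<close>.\<close>

definition EncNat :: "com \<Rightarrow> com" where
  "EncNat c = Seq c (Seq (While (Nonempty 4) (Seq (Pop 4) Inc))
     (Seq (While (Nonempty 8) (Seq (Push 3 True) (Move 8 3))) (Push 3 False)))"

definition enc_cost :: "nat \<Rightarrow> nat \<Rightarrow> nat" where
  "enc_cost Q B = B + ((Q * (7 * Q + 6) + 1) + ((Q * 5 + 1) + 1))"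

lemma emits_EncNat:
  assumes s: "s 4 = []" "s 8 = []" "s 9 = []" and Q: "q \<le> Q"
    and c: "\<And>z. emits 4 c B (s(3 := z)) (replicate q True)"
  shows "emits 3 (EncNat c) (enc_cost Q B) s (enc_nat q)"
  unfolding emits_def
proof
  fix z
  let ?u = "s(3 := z)"
  have 1: "runs c ?u B (?u(4 := replicate q True))"
    using emitsD[OF c[of z]] s by simp
  let ?S = "\<lambda>i. ?u(4 := replicate (q - i) True, 8 := bin i)"
  have inc: "runs (While (Nonempty 4) (Seq (Pop 4) Inc)) (?S 0) (q * (1 + (7 * Q + 4) + 1) + 1) (?S q)"
  proof (rule runs_While)
    fix i assume i: "i < q"
    then have *: "q - i = Suc (q - Suc i)"
      by simp
    show "holds (Nonempty 4) (?S i)"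
      using i by simp
    let ?s = "(?S i)(4 := tl (?S i 4))"
    have "runs Inc ?s (7 * Q + 4) (?S (Suc i))"
      by (rule runs_weaken[OF runs_Inc[where n = i]])
        (use * i Q s in \<open>auto simp: fun_eq_iff\<close>)
    then show "runs (Seq (Pop 4) Inc) (?S i) (1 + (7 * Q + 4)) (?S (Suc i))"
      by (intro runs_Seq[OF runs_Pop])
  qed simp
  have S: "?S 0 = ?u(4 := replicate q True)" "?S q = ?u(8 := bin q)"
    using s by (auto simp: fun_eq_iff)
  have "q * (1 + (7 * Q + 4) + 1) + 1 \<le> Q * (7 * Q + 6) + 1"
    using mult_le_mono1[OF Q, of "7 * Q + 6"] by (simp add: add.commute)
  then have 2: "runs (While (Nonempty 4) (Seq (Pop 4) Inc)) (?u(4 := replicate q True))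
      (Q * (7 * Q + 6) + 1) (?u(8 := bin q))"
    by (rule runs_mono[OF inc[unfolded S]])
  let ?l = "length (bin q)" and ?d = "\<lambda>i. concat (map (\<lambda>b. [True, b]) (take i (bin q)))"
  let ?R = "\<lambda>i. ?u(8 := drop i (bin q), 3 := rev (?d i) @ z)"
  have out: "runs (While (Nonempty 8) (Seq (Push 3 True) (Move 8 3))) (?R 0) (?l * (1 + 3 + 1) + 1) (?R ?l)"
  proof (rule runs_While)
    fix i assume i: "i < ?l"
    show "holds (Nonempty 8) (?R i)"
      using i by simp
    let ?s = "(?R i)(3 := True # ?R i 3)"
    have "?s 8 = bin q ! i # drop (Suc i) (bin q)"
      using i by (simp add: Cons_nth_drop_Suc)
    from runs_Seq[OF runs_Push runs_Move[where s = ?s and j = 3, OF this]]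
    show "runs (Seq (Push 3 True) (Move 8 3)) (?R i) (1 + 3) (?R (Suc i))"
      by (rule runs_weaken) (use i in \<open>auto simp: fun_eq_iff take_Suc_conv_app_nth\<close>)
  qed simp
  have R: "?R 0 = ?u(8 := bin q)" "?R ?l = s(3 := rev (?d ?l) @ z)"
    using s by (auto simp: fun_eq_iff)
  have "?l * (1 + 3 + 1) + 1 \<le> Q * 5 + 1"
    using length_bin_le[of q] Q by simp
  then have 3: "runs (While (Nonempty 8) (Seq (Push 3 True) (Move 8 3))) (?u(8 := bin q))
      (Q * 5 + 1) (s(3 := rev (?d ?l) @ z))"
    by (rule runs_mono[OF out[unfolded R]])
  have 4: "runs (Push 3 False) (s(3 := rev (?d ?l) @ z)) 1 (s(3 := rev (enc_nat q) @ z))"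
    by (rule runs_weaken[OF runs_Push]) (auto simp: enc_nat_def)
  show "runs (EncNat c) ?u (enc_cost Q B) (s(3 := rev (enc_nat q) @ z))"
    using runs_Seq[OF 1 runs_Seq[OF 2 runs_Seq[OF 3 4]]] unfolding EncNat_def enc_cost_def .
qed

section \<open>Printing the new game\<close>

lemma concat_if_replicate:
  "concat (map (\<lambda>i. if P i then replicate q x else []) l) = replicate (length (filter P l) * q) x"
  by (induction l) (simp_all add: replicate_add[symmetric] add.commute)

text \<open>Nested loops around a test visit the pairs of a filtered product in row-major order;
  this turns \<open>ForE\<close> into a loop over \<open>edges\<close>.\<close>

lemma concat_if_product:
  "concat (map (\<lambda>i. concat (map (\<lambda>j. if P i j then f i j else []) js)) us) =
   concat (map (\<lambda>(i, j). f i j) (filter (\<lambda>(i, j). P i j) (List.product us js)))"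
proof (induction us)
  case (Cons i us)
  have "concat (map (\<lambda>j. if P i j then f i j else []) js) =
    concat (map (\<lambda>(i, j). f i j) (filter (\<lambda>(i, j). P i j) (map (Pair i) js)))"
    by (induction js) simp_all
  with Cons show ?case
    by simp
qed simp

definition ForE :: "nat \<Rightarrow> nat \<Rightarrow> nat \<Rightarrow> nat \<Rightarrow> com \<Rightarrow> com" where
  "ForE rx hx ry hy c = For rx hx (For ry hy (IfE hx hy c))"

text \<open>Inside \<open>Pairs\<close>, stack 11 holds the left end of the first edge and 17 the
  right end of the second. Nesting enumerations of all edges, of the neighbours of one end and of
  those of the other multiplies their numbers.\<close>

definition Count :: com where
  "Count = ForE 18 19 20 21 (For 22 23 (IfE 11 23 (For 24 25 (IfE 25 17 (Push 4 True)))))"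

text \<open>The code of 1 is \<open>[True, True, False]\<close> and that of 0 is
  \<open>[False]\<close>, so only a prefix depends on adjacency.\<close>

definition Entry :: com where
  "Entry = Seq (IfE 11 17 (Seq (Push 3 True) (Push 3 True))) (Seq (Push 3 False) (EncNat Count))"

definition Block :: com where
  "Block = Fetch (For 28 29 (For 30 31 (Push 7 True))) 0 3 11 17"

definition Pairs :: "com \<Rightarrow> com" where
  "Pairs c = ForE 10 11 12 13 (ForE 14 15 16 17 c)"

definition Output :: com where
  "Output = (let K = Seq (ForE 10 11 12 13 (Push 3 True)) (Push 3 False) in
     Seq K (Seq K (Seq (Seq (For 28 29 (Push 3 True)) (Push 3 False))
    (Seq (Seq (For 30 31 (Push 3 True)) (Push 3 False))
    (Seq (Pairs Entry) (Pairs Block))))))"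

definition if_cost :: "nat \<Rightarrow> nat \<Rightarrow> nat" where
  "if_cost Z B = fetch_cost Z 1 + (B + 2)"

definition forE_cost :: "nat \<Rightarrow> nat \<Rightarrow> nat" where
  "forE_cost Z B = for_cost Z (for_cost Z (if_cost Z B))"

definition count_cost :: "nat \<Rightarrow> nat" where
  "count_cost Z = forE_cost Z (for_cost Z (if_cost Z (for_cost Z (if_cost Z 1))))"

definition entry_cost :: "nat \<Rightarrow> nat" where
  "entry_cost Z = if_cost Z 2 + (1 + enc_cost (Z * Z * Z) (count_cost Z))"

definition block_cost :: "nat \<Rightarrow> nat" where
  "block_cost Z = fetch_cost Z (for_cost Z (for_cost Z 1))"

definition output_cost :: "nat \<Rightarrow> nat" where
  "output_cost Z = (forE_cost Z 1 + 1) + ((forE_cost Z 1 + 1) + ((for_cost Z 1 + 1) +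
     ((for_cost Z 1 + 1) + (forE_cost Z (forE_cost Z (entry_cost Z)) +
       forE_cost Z (forE_cost Z (block_cost Z))))))"

lemma index_less:
  fixes i j m n :: nat
  assumes "i < m" "j < n" shows "i * n + j < m * n"
proof -
  have "i * n + j < Suc i * n"
    using assms by simp
  also have "\<dots> \<le> m * n"
    using assms by (intro mult_le_mono1) simp
  finally show ?thesis .
qed

text \<open>All that the program knows of a game: sizes, an adjacency table and the predicate bits.
  \<open>Z\<close> is one bound for every loop and every table.\<close>

locale tables =
  fixes m n A B :: nat and tbl V :: "bool list" and e :: "nat \<Rightarrow> nat \<Rightarrow> bool" and Z :: nat
  assumes tbl: "length tbl = m * n" "\<And>i j. i < m \<Longrightarrow> j < n \<Longrightarrow> tbl ! (i * n + j) = e i j"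
    and V: "length V = m * n * (A * B)"
    and Z: "m \<le> Z" "n \<le> Z" "A \<le> Z" "B \<le> Z" "m * n \<le> Z" "m * n * (A * B) \<le> Z"
begin

text \<open>Stacks 3, 4 and 10 to 25 are left free, so that output, counting and surrounding loops
  preserve this invariant.\<close>

definition ready :: "state \<Rightarrow> bool" where
  "ready s \<longleftrightarrow> s 0 = V \<and> s 2 = tbl \<and> s 5 = [] \<and> s 6 = [] \<and> s 7 = [] \<and> s 8 = [] \<and> s 9 = [] \<and>
     s 26 = replicate n True \<and> s 27 = [] \<and> s 28 = replicate A True \<and> s 29 = [] \<and>
     s 30 = replicate B True \<and> s 31 = [] \<and> s 32 = []"

definition edges :: "(nat \<times> nat) list" where
  "edges = filter (\<lambda>(i, j). e i j) (List.product [0..<m] [0..<n])"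

definition degX :: "nat \<Rightarrow> nat" where
  "degX i = length (filter (\<lambda>j. e i j) [0..<n])"

definition degY :: "nat \<Rightarrow> nat" where
  "degY j = length (filter (\<lambda>i. e i j) [0..<m])"

lemma ready_upd: "ready s \<Longrightarrow> k \<in> {3, 4} \<or> k \<in> {10..<26} \<Longrightarrow> ready (s(k := l))"
  unfolding ready_def by auto

lemma emits_IfE':
  assumes "ready s" "s hx = replicate i True" "s hy = replicate j True" "i < m" "j < n"
    "hx \<in> {10..<26}" "hy \<in> {10..<26}" "k \<in> {3, 4}" "e i j \<Longrightarrow> emits k c T s l"
  shows "emits k (IfE hx hy c) (if_cost Z T) s (if e i j then l else [])"
proof -
  have "emits k (IfE hx hy c) (fetch_cost Z 1 + (T + 2)) s (if tbl ! (i * n + j) then l else [])"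
    by (rule emits_IfE) (use assms index_less tbl Z in \<open>auto simp: ready_def\<close>)
  then show ?thesis
    using tbl(2) assms unfolding if_cost_def by simp
qed

lemma emits_ForE:
  assumes s: "ready s" "s rx = replicate m True" "s ry = replicate n True" "s hx = []" "s hy = []"
    and dist: "distinct [rx, hx, ry, hy]" "{rx, hx, ry, hy} \<subseteq> {10..<26}" "k \<in> {3, 4}"
    and c: "\<And>i j. i < m \<Longrightarrow> j < n \<Longrightarrow> e i j \<Longrightarrow> emits k c T
      (s(hx := replicate i True, rx := replicate (m - i) True,
         hy := replicate j True, ry := replicate (n - j) True)) (f (i, j))"
  shows "emits k (ForE rx hx ry hy c) (forE_cost Z T) s (concat (map f edges))"
proof -
  have "emits k (ForE rx hx ry hy c) (forE_cost Z T) s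
     (concat (map (\<lambda>i. concat (map (\<lambda>j. if e i j then f (i, j) else []) [0..<n])) [0..<m]))"
    unfolding ForE_def forE_cost_def
    by (intro emits_For emits_IfE' c ready_upd) (use s dist Z in auto)
  then show ?thesis
    unfolding concat_if_product edges_def by simp
qed

lemma emits_Count:
  assumes s: "ready s" "s 11 = replicate i True" "s 17 = replicate j True" "i < m" "j < n"
    and loops: "\<And>k. k \<in> {19, 21, 23, 25} \<Longrightarrow> s k = []"
      "\<And>k. k \<in> {18, 24} \<Longrightarrow> s k = replicate m True" "\<And>k. k \<in> {20, 22} \<Longrightarrow> s k = replicate n True"
  shows "emits 4 Count (count_cost Z) s (replicate (length edges * degX i * degY j) True)"
proof -
  let ?dY = "concat (map (\<lambda>i'. if e i' j then [True] else []) [0..<m])"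
  let ?dX = "concat (map (\<lambda>j'. if e i j' then ?dY else []) [0..<n])"
  have count: "emits 4 Count (count_cost Z) s (concat (map (\<lambda>_. ?dX) edges))"
    unfolding Count_def count_cost_def
  proof (rule emits_ForE, goal_cases)
    case (9 i' j')
    show ?case
    proof (rule emits_For, goal_cases)
      case (7 j'')
      show ?case
      proof (rule emits_IfE', goal_cases)
        case 9
        show ?case
        proof (rule emits_For, goal_cases)
          case (7 i'')
          show ?case
            by (rule emits_IfE')
              (use s loops \<open>i'' < m\<close> in \<open>auto intro!: ready_upd emits_Push[simplified]\<close>)
        qed (use s loops Z in auto)
      qed (use s loops \<open>j'' < n\<close> in \<open>auto intro!: ready_upd\<close>)
    qed (use s loops Z in auto)
  qed (use s loops in auto)
  have dY: "?dY = replicate (degY j) True"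
    using concat_if_replicate[of "\<lambda>i'. e i' j" 1 True "[0..<m]"]
    unfolding One_nat_def replicate.simps by (simp add: degY_def)
  have dX: "?dX = replicate (degX i * degY j) True"
    unfolding dY degX_def concat_if_replicate by (rule refl)
  have "concat (map (\<lambda>_. replicate q True) l) = replicate (length l * q) True"
    for q and l :: "(nat \<times> nat) list"
    using concat_if_replicate[of "\<lambda>_. True" q True l] by simp
  then show ?thesis
    using count unfolding dX by (simp add: mult.assoc)
qed

lemma length_edges_le: "length edges \<le> Z"
proof -
  have "length edges \<le> length (List.product [0..<m] [0..<n])"
    unfolding edges_def by (rule length_filter_le)
  then show ?thesis
    using Z by simp
qed

lemma deg_le: "degX i \<le> Z" "degY j \<le> Z"
proof -
  show "degX i \<le> Z"
    unfolding degX_def using length_filter_le[of _ "[0..<n]"] Z by (auto intro: order.trans)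
  show "degY j \<le> Z"
    unfolding degY_def using length_filter_le[of _ "[0..<m]"] Z by (auto intro: order.trans)
qed

definition entry :: "nat \<Rightarrow> nat \<Rightarrow> bool list" where
  "entry i j = enc_nat (of_bool (e i j)) @ enc_nat (length edges * degX i * degY j)"

definition block :: "nat \<Rightarrow> nat \<Rightarrow> bool list" where
  "block i j = take (A * B) (drop ((i * n + j) * (A * B)) V)"

lemma emits_Entry:
  assumes s: "ready s" "s 4 = []" "s 11 = replicate i True" "s 17 = replicate j True" "i < m" "j < n"
    and loops: "\<And>k. k \<in> {19, 21, 23, 25} \<Longrightarrow> s k = []"
      "\<And>k. k \<in> {18, 24} \<Longrightarrow> s k = replicate m True" "\<And>k. k \<in> {20, 22} \<Longrightarrow> s k = replicate n True"
  shows "emits 3 Entry (entry_cost Z) s (entry i j)"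
proof -
  have 1: "emits 3 (IfE 11 17 (Seq (Push 3 True) (Push 3 True))) (if_cost Z 2) s
      (if e i j then [True, True] else [])"
    by (rule emits_IfE')
      (use s in \<open>auto intro: emits_mono[OF emits_Seq[OF emits_Push emits_Push]]\<close>)
  have 2: "emits 3 (EncNat Count) (enc_cost (Z * Z * Z) (count_cost Z)) s
      (enc_nat (length edges * degX i * degY j))"
  proof (rule emits_EncNat)
    show "length edges * degX i * degY j \<le> Z * Z * Z"
      by (intro mult_le_mono length_edges_le deg_le)
    show "emits 4 Count (count_cost Z) (s(3 := z)) (replicate (length edges * degX i * degY j) True)"
      for z
      by (rule emits_Count) (use s loops in \<open>auto intro: ready_upd\<close>)
  qed (use s in \<open>auto simp: ready_def\<close>)
  have "(if e i j then [True, True] else []) @ [False] = enc_nat (of_bool (e i j))"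
    by (simp add: enc_nat_def bin_pos)
  then show ?thesis
    unfolding Entry_def entry_cost_def entry_def
    by (intro emits_mono[OF emits_Seq[OF 1 emits_Seq[OF emits_Push 2]]]) simp_all
qed

lemma emits_Block:
  assumes s: "ready s" "s 11 = replicate i True" "s 17 = replicate j True" "i < m" "j < n"
  shows "emits 3 Block (block_cost Z) s (block i j)"
  unfolding Block_def block_cost_def block_def
proof (rule emits_Fetch)
  have "i * n + j + 1 \<le> m * n"
    using index_less[OF s(4,5)] by simp
  then show "(i * n + j + 1) * (A * B) \<le> length V"
    unfolding V by (rule mult_le_mono1)
  fix s' :: state
  assume "\<And>q. q \<in> {28..31} \<Longrightarrow> s' q = s q"
  then have "s' 28 = replicate A True" "s' 29 = []" "s' 30 = replicate B True" "s' 31 = []"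
    using s(1) unfolding ready_def by simp_all
  then have "emits 7 (For 28 29 (For 30 31 (Push 7 True))) (for_cost Z (for_cost Z 1)) s'
      (concat (map (\<lambda>_. concat (map (\<lambda>_. [True]) [0..<B])) [0..<A]))"
    by (intro emits_For emits_Push) (use Z in auto)
  moreover have "concat (map (\<lambda>_. [True]) [0..<B]) = replicate B True"
    using concat_replicate_const[of 1 True B] by simp
  ultimately show "emits 7 (For 28 29 (For 30 31 (Push 7 True))) (for_cost Z (for_cost Z 1)) s'
      (replicate (A * B) True)"
    by (simp add: concat_replicate_const)
qed (use s V Z in \<open>auto simp: ready_def\<close>)

definition result :: "bool list" where
  "result = tally (length edges) @ tally (length edges) @ tally A @ tally B @
     concat (map (\<lambda>(i, _). concat (map (\<lambda>(_, j). entry i j) edges)) edges) @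
     concat (map (\<lambda>(i, _). concat (map (\<lambda>(_, j). block i j) edges)) edges)"

text \<open>Only stacks 10 to 17 may differ when \<open>c\<close> runs, and of the two current edges
  \<open>c\<close> is told the left end of the first and the right end of the second: these are the
  two questions asked.\<close>

lemma emits_Pairs:
  assumes s: "ready s" "\<And>k. k \<in> {11, 13, 15, 17} \<Longrightarrow> s k = []"
      "\<And>k. k \<in> {10, 14} \<Longrightarrow> s k = replicate m True" "\<And>k. k \<in> {12, 16} \<Longrightarrow> s k = replicate n True"
    and c: "\<And>s' i j. (\<And>k. k \<notin> {10..17} \<Longrightarrow> s' k = s k) \<Longrightarrow> i < m \<Longrightarrow> j < n \<Longrightarrow>
      s' 11 = replicate i True \<Longrightarrow> s' 17 = replicate j True \<Longrightarrow> ready s' \<Longrightarrow> emits 3 c T s' (f i j)"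
  shows "emits 3 (Pairs c) (forE_cost Z (forE_cost Z T)) s
    (concat (map (\<lambda>(i, _). concat (map (\<lambda>(_, j). f i j) edges)) edges))"
  unfolding Pairs_def
proof (rule emits_ForE, goal_cases)
  case (9 i j)
  show ?case
    unfolding prod.case
  proof (rule emits_ForE, goal_cases)
    case (9 i' j')
    show ?case
      unfolding prod.case by (rule c) (use s 9 \<open>i < m\<close> in \<open>auto intro!: ready_upd\<close>)
  qed (use s in \<open>auto intro!: ready_upd\<close>)
qed (use s in auto)

lemma emits_Output:
  assumes s: "ready s" "s 4 = []"
    and loops: "\<And>k. k \<in> {11, 13, 15, 17, 19, 21, 23, 25} \<Longrightarrow> s k = []"
      "\<And>k. k \<in> {10, 14, 18, 24} \<Longrightarrow> s k = replicate m True"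
      "\<And>k. k \<in> {12, 16, 20, 22} \<Longrightarrow> s k = replicate n True"
  shows "emits 3 Output (output_cost Z) s result"
proof -
  have "emits 3 (ForE 10 11 12 13 (Push 3 True)) (forE_cost Z 1) s
      (concat (map (\<lambda>_. [True]) edges))"
    by (rule emits_ForE) (use s loops in \<open>auto intro: emits_Push[simplified]\<close>)
  moreover have "concat (map (\<lambda>_. [True]) edges) = replicate (length edges) True"
    using concat_if_replicate[of "\<lambda>_. True" 1 True edges] by simp
  ultimately have "emits 3 (ForE 10 11 12 13 (Push 3 True)) (forE_cost Z 1) s
      (replicate (length edges) True)"
    by simp
  from emits_Seq[OF this emits_Push]
  have K: "emits 3 (Seq (ForE 10 11 12 13 (Push 3 True)) (Push 3 False))
      (forE_cost Z 1 + 1) s (tally (length edges))"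
    unfolding tally_def .
  have For: "emits 3 (Seq (For r h (Push 3 True)) (Push 3 False)) (for_cost Z 1 + 1) s (tally q)"
    if "s r = replicate q True" "s h = []" "q \<le> Z" "r \<noteq> h" "r \<noteq> 3" "h \<noteq> 3" for r h q
  proof -
    have "emits 3 (For r h (Push 3 True)) (for_cost Z 1) s (concat (map (\<lambda>_. [True]) [0..<q]))"
      by (rule emits_For) (use that in \<open>auto intro: emits_Push[simplified]\<close>)
    moreover have "concat (map (\<lambda>_. [True]) [0..<q]) = replicate q True"
      using concat_replicate_const[of 1 True q] by simp
    ultimately have "emits 3 (For r h (Push 3 True)) (for_cost Z 1) s (replicate q True)"
      by simp
    from emits_Seq[OF this emits_Push] show ?thesis
      unfolding tally_def .
  qed
  have AB: "s 28 = replicate A True" "s 29 = []" "s 30 = replicate B True" "s 31 = []"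
    using s(1) unfolding ready_def by simp_all
  have entries: "emits 3 (Pairs Entry) (forE_cost Z (forE_cost Z (entry_cost Z))) s
    (concat (map (\<lambda>(i, _). concat (map (\<lambda>(_, j). entry i j) edges)) edges))"
    by (rule emits_Pairs) (use s loops in \<open>auto intro!: emits_Entry\<close>)
  have blocks: "emits 3 (Pairs Block) (forE_cost Z (forE_cost Z (block_cost Z))) s
    (concat (map (\<lambda>(i, _). concat (map (\<lambda>(_, j). block i j) edges)) edges))"
    by (rule emits_Pairs) (use s loops in \<open>auto intro!: emits_Block\<close>)
  show ?thesis
    unfolding Output_def Let_def output_cost_def result_def
    by (intro emits_Seq K For entries blocks) (use AB Z in auto)
qed

end

section \<open>Reading the input\<close>

fun pushes :: "nat list \<Rightarrow> com" where
  "pushes [] = Skip"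
| "pushes (v # vs) = Seq (Push v True) (pushes vs)"

lemma runs_pushes:
  "distinct vs \<Longrightarrow> runs (pushes vs) s (length vs + 1) (\<lambda>k. if k \<in> set vs then True # s k else s k)"
proof (induction vs arbitrary: s)
  case Nil
  then show ?case
    unfolding runs_def using exec.Skip by auto
next
  case (Cons v vs)
  let ?s = "s(v := True # s v)"
  have "runs (pushes vs) ?s (length vs + 1) (\<lambda>k. if k \<in> set vs then True # ?s k else ?s k)"
    using Cons by simp
  from runs_Seq[OF runs_Push this] show ?case
    by (auto elim!: runs_weaken simp: fun_eq_iff) (use Cons.prems in auto)
qed

text \<open>A loop uses up its stack while it runs, so nested loops over the same range need
  separate copies of the size; one pass over the tally fills them all.\<close>

definition ReadTally :: "nat list \<Rightarrow> com" where
  "ReadTally vs = Seq (While (Top 0) (Seq (Pop 0) (pushes vs))) (Pop 0)"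

text \<open>The factor 8 covers one mark: a test, a \<open>Pop\<close>, at most 5 pushes and the
  closing \<open>Skip\<close>.\<close>

lemma runs_ReadTally:
  assumes s: "s 0 = tally n @ w" "\<And>v. v \<in> set vs \<Longrightarrow> s v = []" and vs: "distinct vs" "0 \<notin> set vs"
    and Z: "n \<le> Z" "length vs \<le> 5"
  shows "runs (ReadTally vs) s (Z * 8 + 2)
           (\<lambda>k. if k \<in> set vs then replicate n True else (s(0 := w)) k)"
proof -
  let ?S = "\<lambda>i k. if k \<in> set vs then replicate i True else (s(0 := tally (n - i) @ w)) k"
  have "runs (While (Top 0) (Seq (Pop 0) (pushes vs))) (?S 0) (n * (1 + (length vs + 1) + 1) + 1) (?S n)"
  proof (rule runs_While)
    fix i assume "i < n"
    then have i: "n - i = Suc (n - Suc i)"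
      by simp
    show "holds (Top 0) (?S i)"
      using i vs by (simp add: tally_def)
    show "runs (Seq (Pop 0) (pushes vs)) (?S i) (1 + (length vs + 1)) (?S (Suc i))"
      by (rule runs_weaken[OF runs_Seq[OF runs_Pop runs_pushes[OF vs(1)]]])
        (use i vs in \<open>auto simp: fun_eq_iff tally_def\<close>)
  qed (use vs in \<open>simp add: tally_def\<close>)
  moreover have "?S 0 = s"
    using s vs by (auto simp: fun_eq_iff)
  ultimately have *: "runs (While (Top 0) (Seq (Pop 0) (pushes vs))) s
      (n * (1 + (length vs + 1) + 1) + 1) (?S n)"
    by simp
  have "n * (1 + (length vs + 1) + 1) \<le> Z * 8"
    by (rule mult_le_mono) (use Z in auto)
  then show ?thesis
    unfolding ReadTally_def
    by (intro runs_weaken[OF runs_Seq[OF * runs_Pop]]) (use vs in \<open>auto simp: fun_eq_iff tally_def\<close>)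
qed

definition SkipNat :: com where
  "SkipNat = Seq (While (Top 0) (Seq (Pop 0) (Pop 0))) (Pop 0)"

lemma runs_SkipNat:
  assumes s: "s 0 = enc_nat q @ w" and Z: "length (enc_nat q) \<le> Z"
  shows "runs SkipNat s (3 * Z + 2) (s(0 := w))"
proof -
  let ?l = "length (bin q)"
  let ?S = "\<lambda>i. s(0 := concat (map (\<lambda>b. [True, b]) (drop i (bin q))) @ [False] @ w)"
  have *: "runs (While (Top 0) (Seq (Pop 0) (Pop 0))) (?S 0) (?l * (1 + 1 + 1) + 1) (?S ?l)"
  proof (rule runs_While)
    fix i assume "i < ?l"
    then have i: "drop i (bin q) = bin q ! i # drop (Suc i) (bin q)"
      by (simp add: Cons_nth_drop_Suc)
    show "holds (Top 0) (?S i)"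
      using i by simp
    show "runs (Seq (Pop 0) (Pop 0)) (?S i) (1 + 1) (?S (Suc i))"
      by (rule runs_weaken[OF runs_Seq[OF runs_Pop runs_Pop]]) (use i in \<open>auto simp: fun_eq_iff\<close>)
  qed simp
  have S: "?S 0 = s"
    using s by (auto simp: fun_eq_iff enc_nat_def)
  have "length (concat (map (\<lambda>b. [True, b]) l)) = 2 * length l" for l
    by (induction l) auto
  then have "?l \<le> Z"
    using Z by (simp add: enc_nat_def)
  then show ?thesis
    unfolding SkipNat_def
    by (intro runs_weaken[OF runs_Seq[OF *[unfolded S] runs_Pop]]) (auto simp: fun_eq_iff)
qed

text \<open>The first bit of a fraction is inspected without being popped, so the two skips still
  meet whole numbers.\<close>

definition ReadEdges :: com where
  "ReadEdges = Seq (For 10 11 (For 12 13 (Push 7 True)))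
    (Seq (While (Nonempty 7)
           (Seq (Pop 7) (Seq (Cond (Top 0) (Push 5 True) (Push 5 False)) (Seq SkipNat SkipNat))))
         (While (Nonempty 5) (Move 5 2)))"

definition enc_frac :: "nat \<times> nat \<Rightarrow> bool list" where
  "enc_frac = (\<lambda>(p, q). enc_nat p @ enc_nat q)"

definition read_cost :: "nat \<Rightarrow> nat" where
  "read_cost Z = for_cost Z (for_cost Z 1) + ((Z * (6 * Z + 8) + 1) + (4 * Z + 1))"

text \<open>The first bit announces whether a digit follows, so that of the numerator already tells
  whether the probability is positive; nothing has to be decoded.\<close>

lemma enc_nat_hd: "\<exists>l. enc_nat p = (p \<noteq> 0) # l"
  by (cases "p = 0") (simp_all add: enc_nat_def bin_pos)

lemma runs_ReadEdges:
  assumes s: "s 0 = concat (map enc_frac ps) @ V" "s 10 = replicate m True" "s 12 = replicate n True"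
      "s 11 = []" "s 13 = []" "s 7 = []" "s 5 = []" "s 2 = []"
    and ps: "length ps = m * n" and Z: "m \<le> Z" "n \<le> Z" "m * n \<le> Z" "length (s 0) \<le> Z"
  shows "runs ReadEdges s (read_cost Z) (s(0 := V, 2 := map (\<lambda>(p, _). p \<noteq> 0) ps))"
proof -
  have "emits 7 (For 10 11 (For 12 13 (Push 7 True))) (for_cost Z (for_cost Z 1)) s
    (concat (map (\<lambda>_. concat (map (\<lambda>_. [True]) [0..<n])) [0..<m]))"
    by (intro emits_For emits_Push) (use s Z in auto)
  moreover have "concat (map (\<lambda>_. [True]) [0..<n]) = replicate n True"
    using concat_replicate_const[of 1 True n] by simp
  ultimately have "emits 7 (For 10 11 (For 12 13 (Push 7 True))) (for_cost Z (for_cost Z 1)) s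
      (replicate (m * n) True)"
    by (simp add: concat_replicate_const)
  from emitsD[OF this] have 1: "runs (For 10 11 (For 12 13 (Push 7 True))) s (for_cost Z (for_cost Z 1))
      (s(7 := replicate (m * n) True))"
    using s by simp
  let ?E = "map (\<lambda>(p, _). p \<noteq> 0)"
  let ?S = "\<lambda>i. s(7 := replicate (m * n - i) True, 0 := concat (map enc_frac (drop i ps)) @ V,
                  5 := rev (?E (take i ps)))"
  let ?c = "Seq (Pop 7) (Seq (Cond (Top 0) (Push 5 True) (Push 5 False)) (Seq SkipNat SkipNat))"
  have 2: "runs (While (Nonempty 7) ?c) (?S 0)
     (m * n * (1 + (2 + ((3 * Z + 2) + (3 * Z + 2))) + 1) + 1) (?S (m * n))"
  proof (rule runs_While)
    fix i assume i: "i < m * n"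
    then have mn: "m * n - i = Suc (m * n - Suc i)"
      by simp
    show "holds (Nonempty 7) (?S i)"
      using i by simp
    obtain p q where pq: "ps ! i = (p, q)"
      by fastforce
    let ?w = "concat (map enc_frac (drop (Suc i) ps)) @ V"
    have d: "drop i ps = (p, q) # drop (Suc i) ps"
      using i ps pq by (simp add: Cons_nth_drop_Suc[symmetric])
    \<comment> \<open>The current fraction is a segment of the initial stack 0, which is how
      \<open>Z\<close> bounds its length.\<close>
    have "concat (map enc_frac ps) = concat (map enc_frac (take i ps)) @ concat (map enc_frac (drop i ps))"
      by (metis append_take_drop_id concat_append map_append)
    then have len: "length (enc_nat p) \<le> Z" "length (enc_nat q) \<le> Z"
      using Z(4) s(1) d by (auto simp: enc_frac_def)
    obtain l where l: "enc_nat p = (p \<noteq> 0) # l"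
      using enc_nat_hd by blast
    let ?s1 = "(?S i)(7 := tl (?S i 7))"
    let ?s2 = "?s1(5 := (p \<noteq> 0) # ?s1 5)"
    have "?s1 0 = (p \<noteq> 0) # (l @ enc_nat q @ ?w)"
      using d l by (simp add: enc_frac_def)
    from runs_copy_top[where s = ?s1, OF this]
    have c: "runs (Cond (Top 0) (Push 5 True) (Push 5 False)) ?s1 2 ?s2" .
    have "?s2 0 = enc_nat p @ (enc_nat q @ ?w)"
      using d by (simp add: enc_frac_def)
    from runs_SkipNat[where s = ?s2, OF this len(1)]
    have p: "runs SkipNat ?s2 (3 * Z + 2) (?s2(0 := enc_nat q @ ?w))" .
    have q: "runs SkipNat (?s2(0 := enc_nat q @ ?w)) (3 * Z + 2) (?S (Suc i))"
      by (rule runs_weaken[OF runs_SkipNat[OF _ len(2), where w = ?w]])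
        (use mn pq i ps in \<open>auto simp: fun_eq_iff take_Suc_conv_app_nth\<close>)
    show "runs ?c (?S i) (1 + (2 + ((3 * Z + 2) + (3 * Z + 2)))) (?S (Suc i))"
      by (rule runs_Seq[OF runs_Pop runs_Seq[OF c runs_Seq[OF p q]]])
  qed simp
  have S: "?S 0 = s(7 := replicate (m * n) True)" "?S (m * n) = s(0 := V, 5 := rev (?E ps))"
    using s ps by (auto simp: fun_eq_iff)
  have "m * n * (1 + (2 + ((3 * Z + 2) + (3 * Z + 2))) + 1) + 1 \<le> Z * (6 * Z + 8) + 1"
    using mult_le_mono1[OF Z(3), of "6 * Z + 8"] by (simp add: algebra_simps)
  from runs_mono[OF 2[unfolded S] this]
  have 3: "runs (While (Nonempty 7) ?c) (s(7 := replicate (m * n) True)) (Z * (6 * Z + 8) + 1)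
      (s(0 := V, 5 := rev (?E ps)))" .
  have 4: "runs (While (Nonempty 5) (Move 5 2)) (s(0 := V, 5 := rev (?E ps))) (4 * Z + 1)
      (s(0 := V, 2 := ?E ps))"
    by (rule runs_weaken[OF runs_pour]) (use s Z ps in \<open>auto simp: fun_eq_iff rev_map\<close>)
  show ?thesis
    unfolding ReadEdges_def read_cost_def by (rule runs_Seq[OF 1 runs_Seq[OF 3 4]])
qed

definition Program :: com where
  "Program = Seq (ReadTally [10, 14, 18, 24]) (Seq (ReadTally [12, 16, 20, 22, 26])
     (Seq (ReadTally [28]) (Seq (ReadTally [30]) (Seq ReadEdges
     (Seq Output (While (Nonempty 3) (Move 3 1)))))))"

definition total_cost :: "nat \<Rightarrow> nat" where
  "total_cost Z = (Z * 8 + 2) + ((Z * 8 + 2) + ((Z * 8 + 2) + ((Z * 8 + 2) + (read_cost Z +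
     (output_cost Z + (4 * output_cost Z + 1))))))"

text \<open>Bounds the time of the final reversal of the output.\<close>

lemma exec_length: "exec c s t s' \<Longrightarrow> length (s' k) \<le> length (s k) + t"
  by (induction rule: exec.induct) (auto split: if_splits)

context tables
begin

lemma computes_Program:
  assumes ps: "length ps = m * n" "tbl = map (\<lambda>(p, _). p \<noteq> 0) ps"
    and w: "w = tally m @ tally n @ tally A @ tally B @ concat (map enc_frac ps) @ V" "length w \<le> Z"
  shows "\<exists>t\<le>total_cost Z. computes Program w t result"
proof -
  let ?w1 = "tally n @ tally A @ tally B @ concat (map enc_frac ps) @ V"
  let ?w2 = "tally A @ tally B @ concat (map enc_frac ps) @ V"
  let ?w3 = "tally B @ concat (map enc_frac ps) @ V"
  let ?w4 = "concat (map enc_frac ps) @ V"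
  let ?ms = "[10, 14, 18, 24] :: nat list" and ?ns = "[12, 16, 20, 22, 26] :: nat list"
  let ?s0 = "(\<lambda>_. [])(0 := w)"
  let ?s1 = "\<lambda>k. if k \<in> set ?ms then replicate m True else (?s0(0 := ?w1)) k"
  let ?s2 = "\<lambda>k. if k \<in> set ?ns then replicate n True else (?s1(0 := ?w2)) k"
  let ?s3 = "\<lambda>k. if k \<in> set [28] then replicate A True else (?s2(0 := ?w3)) k"
  let ?s4 = "\<lambda>k. if k \<in> set [30] then replicate B True else (?s3(0 := ?w4)) k"
  let ?s5 = "?s4(0 := V, 2 := tbl)"
  have 1: "runs (ReadTally ?ms) ?s0 (Z * 8 + 2) ?s1"
    by (rule runs_ReadTally) (use w Z in auto)
  have 2: "runs (ReadTally ?ns) ?s1 (Z * 8 + 2) ?s2"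
    by (rule runs_ReadTally) (use w Z in auto)
  have 3: "runs (ReadTally [28]) ?s2 (Z * 8 + 2) ?s3"
    by (rule runs_ReadTally) (use w Z in auto)
  have 4: "runs (ReadTally [30]) ?s3 (Z * 8 + 2) ?s4"
    by (rule runs_ReadTally) (use w Z in auto)
  have 5: "runs ReadEdges ?s4 (read_cost Z) ?s5"
    unfolding ps(2) by (rule runs_ReadEdges) (use w Z ps in auto)
  have "emits 3 Output (output_cost Z) ?s5 result"
    by (rule emits_Output) (auto simp: ready_def)
  from emitsD[OF this] have 6: "runs Output ?s5 (output_cost Z) (?s5(3 := rev result))"
    by simp
  then have len: "length result \<le> output_cost Z"
    unfolding runs_def using exec_length[where k = 3] by fastforce
  have 7: "runs (While (Nonempty 3) (Move 3 1)) (?s5(3 := rev result)) (4 * output_cost Z + 1)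
      (?s5(1 := result))"
    by (rule runs_weaken[OF runs_pour]) (use len in \<open>auto simp: fun_eq_iff\<close>)
  have "runs Program ?s0 (total_cost Z) (?s5(1 := result))"
    unfolding Program_def total_cost_def
    by (rule runs_Seq[OF 1 runs_Seq[OF 2 runs_Seq[OF 3 runs_Seq[OF 4 runs_Seq[OF 5 runs_Seq[OF 6 7]]]]]])
  then show ?thesis
    unfolding runs_def computes_def
    by (elim exE conjE) (intro exI conjI, assumption, assumption, rule fun_upd_same)
qed

end

section \<open>Polynomial bound on the running time\<close>

definition is_poly :: "(nat \<Rightarrow> nat) \<Rightarrow> bool" where
  "is_poly f \<longleftrightarrow> (\<exists>p. \<forall>n. f n = poly p n)"

lemma is_poly_const: "is_poly (\<lambda>_. c)"
  unfolding is_poly_def by (intro exI[of _ "[:c:]"]) simp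

lemma is_poly_id: "is_poly (\<lambda>n. n)"
  unfolding is_poly_def by (intro exI[of _ "[:0, 1:]"]) simp

lemma is_poly_add: "is_poly f \<Longrightarrow> is_poly g \<Longrightarrow> is_poly (\<lambda>n. f n + g n)"
  unfolding is_poly_def by (metis poly_add)

lemma is_poly_mult: "is_poly f \<Longrightarrow> is_poly g \<Longrightarrow> is_poly (\<lambda>n. f n * g n)"
  unfolding is_poly_def by (metis poly_mult)

text \<open>The nesting depth of the loops is fixed, so the cost arises from \<open>Z\<close> and
  constants by finitely many sums and products.\<close>

lemma is_poly_total_cost: "is_poly total_cost"
  unfolding total_cost_def[abs_def] read_cost_def output_cost_def entry_cost_def block_cost_def
    count_cost_def forE_cost_def if_cost_def for_cost_def fetch_cost_def enc_cost_def
  by (intro is_poly_add is_poly_mult is_poly_id is_poly_const)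

section \<open>Averaging strategies over copies of questions\<close>

lemma sum_swap_pairs:
  "(\<Sum>i\<in>A. \<Sum>j\<in>B. \<Sum>k\<in>C. \<Sum>l\<in>D. h i j k l) = (\<Sum>k\<in>C. \<Sum>l\<in>D. \<Sum>i\<in>A. \<Sum>j\<in>B. h i j k l)"
proof -
  have "(\<Sum>p\<in>A \<times> B. \<Sum>q\<in>C \<times> D. h (fst p) (snd p) (fst q) (snd q)) =
    (\<Sum>q\<in>C \<times> D. \<Sum>p\<in>A \<times> B. h (fst p) (snd p) (fst q) (snd q))"
    by (rule sum.swap)
  then show ?thesis
    by (simp add: sum.cartesian_product')
qed

section \<open>Quadratic forms of averaged matrices\<close>

lemma qform_eq_sum:
  fixes M :: "complex mat"
  assumes "M \<in> carrier_mat d d" "v \<in> carrier_vec d"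
  shows "(M *\<^sub>v v) \<bullet>c v = (\<Sum>i<d. \<Sum>j<d. M $$ (i, j) * (v $ j * cnj (v $ i)))"
  using assms
  by (auto simp: scalar_prod_def lessThan_atLeast0 sum_distrib_right mult.assoc intro!: sum.cong)

lemma mat_adjoint_eq_self_iff:
  fixes M :: "complex mat"
  assumes "M \<in> carrier_mat d d"
  shows "mat_adjoint M = M \<longleftrightarrow> (\<forall>i<d. \<forall>j<d. cnj (M $$ (j, i)) = M $$ (i, j))"
  using assms by (auto simp: mat_eq_iff mat_adjoint_def mat_of_rows_def)

lemma kron_carrier:
  "M \<in> carrier_mat d d \<Longrightarrow> N \<in> carrier_mat d d \<Longrightarrow> kron M N \<in> carrier_mat (d * d) (d * d)"
  by (auto simp: kron_def)

lemma qform_kron: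
  assumes "M \<in> carrier_mat d d" "N \<in> carrier_mat d d" "v \<in> carrier_vec (d * d)"
  shows "(kron M N *\<^sub>v v) \<bullet>c v = (\<Sum>r<d * d. \<Sum>c<d * d.
    M $$ (r div d, c div d) * N $$ (r mod d, c mod d) * (v $ c * cnj (v $ r)))"
  unfolding qform_eq_sum[OF kron_carrier[OF assms(1,2)] assms(3)]
  using assms(1,2) by (intro sum.cong) (auto simp: kron_def)

definition avg_mat :: "nat \<Rightarrow> 'q set \<Rightarrow> ('q \<Rightarrow> complex mat) \<Rightarrow> complex mat" where
  "avg_mat d S M = mat d d (\<lambda>ij. (\<Sum>q\<in>S. M q $$ ij) / of_nat (card S))"

lemma avg_mat_carrier: "avg_mat d S M \<in> carrier_mat d d"
  by (simp add: avg_mat_def)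

text \<open>Hermitian symmetry, read entrywise, and nonnegativity of the quadratic form both pass to
  sums and to quotients by a natural number.\<close>

lemma psd_avg_mat:
  assumes M: "\<And>q. q \<in> S \<Longrightarrow> M q \<in> carrier_mat d d \<and> psd (M q)"
  shows "psd (avg_mat d S M)"
proof -
  have adj: "cnj (M q $$ (j, i)) = M q $$ (i, j)" if "q \<in> S" "i < d" "j < d" for q i j
    using M[OF that(1)] that(2,3) mat_adjoint_eq_self_iff[of "M q" d] unfolding psd_def by blast
  have "mat_adjoint (avg_mat d S M) = avg_mat d S M"
    unfolding mat_adjoint_eq_self_iff[OF avg_mat_carrier]
  proof (intro allI impI)
    fix i j assume ij: "i < d" "j < d"
    have "(\<Sum>q\<in>S. cnj (M q $$ (j, i))) = (\<Sum>q\<in>S. M q $$ (i, j))"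
      by (rule sum.cong[OF refl adj[OF _ ij]])
    then show "cnj (avg_mat d S M $$ (j, i)) = avg_mat d S M $$ (i, j)"
      using ij by (simp add: avg_mat_def)
  qed
  moreover have "0 \<le> Re ((avg_mat d S M *\<^sub>v v) \<bullet>c v)" if v: "v \<in> carrier_vec d" for v
  proof -
    have "(avg_mat d S M *\<^sub>v v) \<bullet>c v =
      (\<Sum>i<d. \<Sum>j<d. \<Sum>q\<in>S. M q $$ (i, j) * (v $ j * cnj (v $ i)) / of_nat (card S))"
      unfolding qform_eq_sum[OF avg_mat_carrier v]
      by (intro sum.cong) (auto simp: avg_mat_def sum_distrib_right sum_divide_distrib)
    also have "\<dots> = (\<Sum>i<d. \<Sum>q\<in>S. \<Sum>j<d. M q $$ (i, j) * (v $ j * cnj (v $ i)) / of_nat (card S))"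
      by (intro sum.cong refl sum.swap)
    also have "\<dots> = (\<Sum>q\<in>S. \<Sum>i<d. \<Sum>j<d. M q $$ (i, j) * (v $ j * cnj (v $ i)) / of_nat (card S))"
      by (rule sum.swap)
    also have "\<dots> = (\<Sum>q\<in>S. (M q *\<^sub>v v) \<bullet>c v / of_nat (card S))"
      by (intro sum.cong) (simp_all add: qform_eq_sum[OF conjunct1[OF M] v] sum_divide_distrib)
    finally have "Re ((avg_mat d S M *\<^sub>v v) \<bullet>c v) =
        (\<Sum>q\<in>S. Re ((M q *\<^sub>v v) \<bullet>c v) / of_nat (card S))"
      by (simp add: Re_divide_of_nat)
    moreover have "0 \<le> Re ((M q *\<^sub>v v) \<bullet>c v)" if "q \<in> S" for q
      using M[OF that] v unfolding psd_def by auto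
    ultimately show ?thesis
      by (auto intro!: sum_nonneg)
  qed
  ultimately show ?thesis
    unfolding psd_def by (simp add: avg_mat_def)
qed

text \<open>Bilinearity of the Kronecker product: averaging the two factors separately is averaging
  over all pairs.\<close>

lemma qform_kron_avg:
  assumes M: "\<And>q. q \<in> S \<Longrightarrow> M q \<in> carrier_mat d d" and N: "\<And>q. q \<in> T \<Longrightarrow> N q \<in> carrier_mat d d"
    and v: "v \<in> carrier_vec (d * d)"
  shows "Re ((kron (avg_mat d S M) (avg_mat d T N) *\<^sub>v v) \<bullet>c v) =
    (\<Sum>q\<in>S. \<Sum>q'\<in>T. Re ((kron (M q) (N q') *\<^sub>v v) \<bullet>c v)) / (real (card S) * real (card T))"
proof -
  let ?t = "\<lambda>q q' r c. M q $$ (r div d, c div d) * N q' $$ (r mod d, c mod d) * (v $ c * cnj (v $ r))"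
  let ?K = "of_nat (card S) * of_nat (card T) :: complex"
  have "(kron (avg_mat d S M) (avg_mat d T N) *\<^sub>v v) \<bullet>c v =
    (\<Sum>r<d * d. \<Sum>c<d * d. \<Sum>q\<in>S. \<Sum>q'\<in>T. ?t q q' r c / ?K)"
    unfolding qform_kron[OF avg_mat_carrier avg_mat_carrier v]
  proof (intro sum.cong refl)
    fix r c assume "r \<in> {..<d * d}" "c \<in> {..<d * d}"
    then have "r div d < d" "c div d < d"
      by (auto simp: less_mult_imp_div_less)
    \<comment> \<open>A quotient below \<open>d\<close> forces \<open>d > 0\<close>, which bounds
      the remainders.\<close>
    moreover from this have "r mod d < d" "c mod d < d"
      by auto
    ultimately have "avg_mat d S M $$ (r div d, c div d) * avg_mat d T N $$ (r mod d, c mod d) *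
        (v $ c * cnj (v $ r)) =
      (\<Sum>q\<in>S. M q $$ (r div d, c div d)) * (\<Sum>q'\<in>T. N q' $$ (r mod d, c mod d)) *
        (v $ c * cnj (v $ r)) / ?K"
      by (simp add: avg_mat_def)
    also have "\<dots> = (\<Sum>q\<in>S. \<Sum>q'\<in>T. ?t q q' r c / ?K)"
      unfolding sum_product by (simp only: sum_distrib_right sum_divide_distrib)
    finally show "avg_mat d S M $$ (r div d, c div d) * avg_mat d T N $$ (r mod d, c mod d) *
        (v $ c * cnj (v $ r)) = (\<Sum>q\<in>S. \<Sum>q'\<in>T. ?t q q' r c / ?K)" .
  qed
  also have "\<dots> = (\<Sum>q\<in>S. \<Sum>q'\<in>T. \<Sum>r<d * d. \<Sum>c<d * d. ?t q q' r c / ?K)"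
    by (rule sum_swap_pairs)
  also have "\<dots> = (\<Sum>q\<in>S. \<Sum>q'\<in>T. (kron (M q) (N q') *\<^sub>v v) \<bullet>c v / ?K)"
    by (intro sum.cong) (simp_all add: qform_kron[OF M N v] sum_divide_distrib)
  also have "\<dots> = (\<Sum>q\<in>S. \<Sum>q'\<in>T. (kron (M q) (N q') *\<^sub>v v) \<bullet>c v) / of_nat (card S * card T)"
    by (simp add: sum_divide_distrib)
  finally show ?thesis
    by (simp only: Re_divide_of_nat[of _ "card S * card T"] Re_sum of_nat_mult[where 'a = real])
qed

text \<open>Common shape of both values: \<open>t x y a b\<close> stands for the probability of the
  answers \<open>a\<close>, \<open>b\<close>, be it a product of classical strategies or a quantum
  correlation.\<close>

definition payoff :: "('q, 'r, 'a, 'b) game \<Rightarrow> ('q \<Rightarrow> 'r \<Rightarrow> 'a \<Rightarrow> 'b \<Rightarrow> real) \<Rightarrow> real" where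
  "payoff H t = (\<Sum>x\<in>qX H. \<Sum>y\<in>qY H. mu H x y *
     (\<Sum>a\<in>ansA H. \<Sum>b\<in>ansB H. of_bool (win H a b x y) * t x y a b))"

text \<open>Independent of graphs: the mass of a question pair is spread evenly over its fibre,
  whatever the fibre sizes. In the application these are the degrees.\<close>

locale blowup =
  fixes G :: "('x, 'y, 'a, 'b) game" and G' :: "('u, 'v, 'a, 'b) game"
    and \<pi> :: "'u \<Rightarrow> 'x" and \<rho> :: "'v \<Rightarrow> 'y"
  assumes fin: "finite (qX G)" "finite (qY G)" "finite (qX G')" "finite (qY G')"
    and nonempty: "qX G' \<noteq> {}" "qY G' \<noteq> {}"
    and proj: "\<pi> ` qX G' \<subseteq> qX G" "\<rho> ` qY G' \<subseteq> qY G"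
    and ans: "ansA G' = ansA G" "ansB G' = ansB G"
    and win: "\<And>u v a b. u \<in> qX G' \<Longrightarrow> v \<in> qY G' \<Longrightarrow> win G' a b u v = win G a b (\<pi> u) (\<rho> v)"
    and mu: "\<And>u v. u \<in> qX G' \<Longrightarrow> v \<in> qY G' \<Longrightarrow> mu G' u v = mu G (\<pi> u) (\<rho> v) /
      (real (card {u' \<in> qX G'. \<pi> u' = \<pi> u}) * real (card {v' \<in> qY G'. \<rho> v' = \<rho> v}))"
    and surj: "\<And>x y. x \<in> qX G \<Longrightarrow> y \<in> qY G \<Longrightarrow> mu G x y \<noteq> 0 \<Longrightarrow> x \<in> \<pi> ` qX G' \<and> y \<in> \<rho> ` qY G'"
begin

text \<open>Questions of probability zero may have an empty fibre. They do not affect the payoff, but a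
  strategy must answer them too, so they borrow the fibre of some other question.\<close>

definition fibX :: "'x \<Rightarrow> 'u set" where
  "fibX x = {u \<in> qX G'. \<pi> u = (if x \<in> \<pi> ` qX G' then x else \<pi> (SOME u. u \<in> qX G'))}"

definition fibY :: "'y \<Rightarrow> 'v set" where
  "fibY y = {v \<in> qY G'. \<rho> v = (if y \<in> \<rho> ` qY G' then y else \<rho> (SOME v. v \<in> qY G'))}"

lemma fib_subset: "fibX x \<subseteq> qX G'" "fibY y \<subseteq> qY G'"
  by (auto simp: fibX_def fibY_def)

lemma card_fib: "card (fibX x) > 0" "card (fibY y) > 0"
proof -
  have some: "(SOME u. u \<in> qX G') \<in> qX G'" "(SOME v. v \<in> qY G') \<in> qY G'"
    using nonempty by (simp_all add: some_in_eq)
  have "\<exists>u. u \<in> fibX x"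
  proof (cases "x \<in> \<pi> ` qX G'")
    case True
    then obtain u where "u \<in> qX G'" "\<pi> u = x"
      by blast
    with True show ?thesis
      unfolding fibX_def by (intro exI[of _ u]) simp
  qed (use some(1) in \<open>auto simp only: fibX_def if_False mem_Collect_eq\<close>)
  moreover have "\<exists>v. v \<in> fibY y"
  proof (cases "y \<in> \<rho> ` qY G'")
    case True
    then obtain v where "v \<in> qY G'" "\<rho> v = y"
      by blast
    with True show ?thesis
      unfolding fibY_def by (intro exI[of _ v]) simp
  qed (use some(2) in \<open>auto simp only: fibY_def if_False mem_Collect_eq\<close>)
  moreover have "finite (fibX x)" "finite (fibY y)"
    by (rule finite_subset[OF fib_subset(1) fin(3)], rule finite_subset[OF fib_subset(2) fin(4)])
  ultimately show "card (fibX x) > 0" "card (fibY y) > 0"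
    by (auto simp only: card_gt_0_iff)
qed

text \<open>Drawing a pair in \<open>G'\<close> amounts to drawing one in \<open>G\<close> and then
  independent uniform copies; formally, the copies are grouped by their projections.\<close>

lemma sum_mu:
  "(\<Sum>u\<in>qX G'. \<Sum>v\<in>qY G'. mu G' u v * h u v) =
   (\<Sum>x\<in>qX G. \<Sum>y\<in>qY G. mu G x y *
     ((\<Sum>u\<in>fibX x. \<Sum>v\<in>fibY y. h u v) / (real (card (fibX x)) * real (card (fibY y)))))"
proof -
  let ?F = "\<lambda>x. {u \<in> qX G'. \<pi> u = x}" and ?H = "\<lambda>y. {v \<in> qY G'. \<rho> v = y}"
  have "(\<Sum>u\<in>qX G'. \<Sum>v\<in>qY G'. mu G' u v * h u v) =
    (\<Sum>u\<in>qX G'. \<Sum>y\<in>qY G. \<Sum>v\<in>?H y. mu G' u v * h u v)"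
    using fin proj by (intro sum.cong refl sum.group[symmetric])
  also have "\<dots> = (\<Sum>x\<in>qX G. \<Sum>u\<in>?F x. \<Sum>y\<in>qY G. \<Sum>v\<in>?H y. mu G' u v * h u v)"
    using fin proj by (intro sum.group[symmetric])
  also have "\<dots> = (\<Sum>x\<in>qX G. \<Sum>y\<in>qY G. \<Sum>u\<in>?F x. \<Sum>v\<in>?H y. mu G' u v * h u v)"
    by (intro sum.cong refl sum.swap)
  also have "\<dots> = (\<Sum>x\<in>qX G. \<Sum>y\<in>qY G. mu G x y *
     ((\<Sum>u\<in>fibX x. \<Sum>v\<in>fibY y. h u v) / (real (card (fibX x)) * real (card (fibY y)))))"
  proof (intro sum.cong refl)
    fix x y assume xy: "x \<in> qX G" "y \<in> qY G"
    have "(\<Sum>u\<in>?F x. \<Sum>v\<in>?H y. mu G' u v * h u v) = (\<Sum>u\<in>?F x. \<Sum>v\<in>?H y.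
        mu G x y * (h u v / (real (card (?F x)) * real (card (?H y)))))"
      by (intro sum.cong refl) (auto simp: mu)
    also have "\<dots> = mu G x y *
        ((\<Sum>u\<in>?F x. \<Sum>v\<in>?H y. h u v) / (real (card (?F x)) * real (card (?H y))))"
      by (simp only: sum_distrib_left sum_divide_distrib)
    also have "\<dots> = mu G x y *
        ((\<Sum>u\<in>fibX x. \<Sum>v\<in>fibY y. h u v) / (real (card (fibX x)) * real (card (fibY y))))"
    \<comment> \<open>A borrowed fibre can occur only at probability zero, where both sides
      vanish.\<close>
    proof (cases "mu G x y = 0")
      case False
      then have "fibX x = ?F x" "fibY y = ?H y"
        using surj[OF xy] by (auto simp: fibX_def fibY_def)
      then show ?thesis
        by simp
    qed simp
    finally show "(\<Sum>u\<in>?F x. \<Sum>v\<in>?H y. mu G' u v * h u v) = mu G x y *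
        ((\<Sum>u\<in>fibX x. \<Sum>v\<in>fibY y. h u v) / (real (card (fibX x)) * real (card (fibY y))))" .
  qed
  finally show ?thesis .
qed

text \<open>Where the mass is positive, the predicate is constant on the pair of fibres and leaves
  the average. Averaging a strategy and copying one are both instances.\<close>

lemma payoff_eqI:
  assumes "\<And>x y a b. x \<in> qX G \<Longrightarrow> y \<in> qY G \<Longrightarrow> mu G x y \<noteq> 0 \<Longrightarrow> a \<in> ansA G \<Longrightarrow> b \<in> ansB G \<Longrightarrow>
    t x y a b = (\<Sum>u\<in>fibX x. \<Sum>v\<in>fibY y. t' u v a b) / (real (card (fibX x)) * real (card (fibY y)))"
  shows "payoff G' t' = payoff G t"
  unfolding payoff_def sum_mu
proof (intro sum.cong refl)
  fix x y assume xy: "x \<in> qX G" "y \<in> qY G"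
  let ?K = "real (card (fibX x)) * real (card (fibY y))"
  show "mu G x y * ((\<Sum>u\<in>fibX x. \<Sum>v\<in>fibY y. \<Sum>a\<in>ansA G'. \<Sum>b\<in>ansB G'.
      of_bool (win G' a b u v) * t' u v a b) / ?K) =
    mu G x y * (\<Sum>a\<in>ansA G. \<Sum>b\<in>ansB G. of_bool (win G a b x y) * t x y a b)"
  proof (cases "mu G x y = 0")
    case False
    have w: "win G' a b u v = win G a b x y" if "u \<in> fibX x" "v \<in> fibY y" for u v a b
      using that surj[OF xy False] by (auto simp: fibX_def fibY_def win)
    have "(\<Sum>u\<in>fibX x. \<Sum>v\<in>fibY y. \<Sum>a\<in>ansA G'. \<Sum>b\<in>ansB G'. of_bool (win G' a b u v) * t' u v a b) =
      (\<Sum>u\<in>fibX x. \<Sum>v\<in>fibY y. \<Sum>a\<in>ansA G. \<Sum>b\<in>ansB G. of_bool (win G a b x y) * t' u v a b)"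
      by (intro sum.cong) (simp_all add: ans w)
    also have "\<dots> = (\<Sum>a\<in>ansA G. \<Sum>b\<in>ansB G. \<Sum>u\<in>fibX x. \<Sum>v\<in>fibY y. of_bool (win G a b x y) * t' u v a b)"
      by (rule sum_swap_pairs)
    also have "\<dots> / ?K = (\<Sum>a\<in>ansA G. \<Sum>b\<in>ansB G. of_bool (win G a b x y) * t x y a b)"
      by (auto simp: assms[OF xy False] sum_divide_distrib sum_distrib_left intro!: sum.cong)
    finally show ?thesis
      by simp
  qed simp
qed

lemma payoff_pullback: "payoff G' (\<lambda>u v. t (\<pi> u) (\<rho> v)) = payoff G t"
proof (rule payoff_eqI)
  fix x y a b assume xy: "x \<in> qX G" "y \<in> qY G" "mu G x y \<noteq> 0"
  have "(\<Sum>u\<in>fibX x. \<Sum>v\<in>fibY y. t (\<pi> u) (\<rho> v) a b) = (\<Sum>u\<in>fibX x. \<Sum>v\<in>fibY y. t x y a b)"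
    using surj[OF xy] by (intro sum.cong) (auto simp: fibX_def fibY_def)
  then show "t x y a b = (\<Sum>u\<in>fibX x. \<Sum>v\<in>fibY y. t (\<pi> u) (\<rho> v) a b) /
      (real (card (fibX x)) * real (card (fibY y)))"
    using card_fib(1)[of x] card_fib(2)[of y] by simp
qed

end

lemma strategy_pullback: "strategy Q A f \<Longrightarrow> h ` R \<subseteq> Q \<Longrightarrow> strategy R A (\<lambda>u. f (h u))"
  unfolding strategy_def by blast

lemma povms_pullback: "povms d Q A P \<Longrightarrow> h ` R \<subseteq> Q \<Longrightarrow> povms d R A (\<lambda>u. P (h u))"
  unfolding povms_def by blast

text \<open>Probability distributions form a convex set; the positive cardinality rules out division
  by zero.\<close>

lemma strategy_avg:
  assumes f: "strategy R A f" and F: "\<And>q. F q \<subseteq> R" "\<And>q. card (F q) > 0"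
  shows "strategy Q A (\<lambda>q a. (\<Sum>u\<in>F q. f u a) / real (card (F q)))"
  unfolding strategy_def
proof (intro ballI conjI)
  fix q a assume a: "a \<in> A"
  have b: "0 \<le> f u a" "f u a \<le> 1" if "u \<in> F q" for u
    using f a F(1) that unfolding strategy_def by blast+
  show "0 \<le> (\<Sum>u\<in>F q. f u a) / real (card (F q))"
    using b by (simp add: sum_nonneg)
  have "(\<Sum>u\<in>F q. f u a) \<le> real (card (F q))"
    using sum_mono[of "F q" "\<lambda>u. f u a" "\<lambda>_. 1"] b by simp
  then show "(\<Sum>u\<in>F q. f u a) / real (card (F q)) \<le> 1"
    using F(2)[of q] by simp
next
  fix q
  have "(\<Sum>a\<in>A. (\<Sum>u\<in>F q. f u a) / real (card (F q))) = (\<Sum>u\<in>F q. \<Sum>a\<in>A. f u a) / real (card (F q))"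
    unfolding sum_divide_distrib[symmetric] by (subst sum.swap) (rule refl)
  also have "(\<Sum>u\<in>F q. \<Sum>a\<in>A. f u a) = (\<Sum>u\<in>F q. 1)"
    using f F(1) unfolding strategy_def by (intro sum.cong) blast+
  finally show "(\<Sum>a\<in>A. (\<Sum>u\<in>F q. f u a) / real (card (F q))) = 1"
    using F(2)[of q] by simp
qed

text \<open>Exchanging the average with the sum over answers leaves an average of identity
  matrices.\<close>

lemma povms_avg:
  assumes P: "povms d R A P" and F: "\<And>q. F q \<subseteq> R" "\<And>q. card (F q) > 0"
  shows "povms d Q A (\<lambda>q a. avg_mat d (F q) (\<lambda>u. P u a))"
  unfolding povms_def
proof (intro ballI conjI)
  fix q a assume "a \<in> A"
  then show "avg_mat d (F q) (\<lambda>u. P u a) \<in> carrier_mat d d" "psd (avg_mat d (F q) (\<lambda>u. P u a))"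
    using P F(1) unfolding povms_def by (blast intro: avg_mat_carrier psd_avg_mat)+
next
  fix q
  have one: "(\<Sum>a\<in>A. P u a $$ ij) = 1\<^sub>m d $$ ij" if "u \<in> F q" "ij \<in> {..<d} \<times> {..<d}" for u ij
  proof -
    have "mat d d (\<lambda>ij. \<Sum>a\<in>A. P u a $$ ij) = 1\<^sub>m d"
      using P F(1) that(1) unfolding povms_def by blast
    then have "mat d d (\<lambda>ij. \<Sum>a\<in>A. P u a $$ ij) $$ ij = 1\<^sub>m d $$ ij"
      by simp
    then show ?thesis
      using that(2) by auto
  qed
  show "mat d d (\<lambda>ij. \<Sum>a\<in>A. avg_mat d (F q) (\<lambda>u. P u a) $$ ij) = 1\<^sub>m d"
  proof (rule eq_matI)
    fix i j assume "i < dim_row (1\<^sub>m d :: complex mat)" "j < dim_col (1\<^sub>m d :: complex mat)"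
    then have ij: "i < d" "j < d"
      by simp_all
    then have "mat d d (\<lambda>ij. \<Sum>a\<in>A. avg_mat d (F q) (\<lambda>u. P u a) $$ ij) $$ (i, j) =
      (\<Sum>u\<in>F q. \<Sum>a\<in>A. P u a $$ (i, j)) / of_nat (card (F q))"
      by (simp add: avg_mat_def sum_divide_distrib[symmetric]) (intro disjI2 sum.swap)
    also have "(\<Sum>u\<in>F q. \<Sum>a\<in>A. P u a $$ (i, j)) = (\<Sum>u\<in>F q. 1\<^sub>m d $$ (i, j))"
      using ij by (intro sum.cong refl one) auto
    finally show "mat d d (\<lambda>ij. \<Sum>a\<in>A. avg_mat d (F q) (\<lambda>u. P u a) $$ ij) $$ (i, j) = 1\<^sub>m d $$ (i, j)"
      using F(2)[of q] by simp
  qed simp_all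
qed

context blowup
begin

text \<open>Equality of the sets of payoffs also settles the degenerate case: an empty answer set
  leaves no strategies in either game.\<close>

lemma Val_eq: "Val G' = Val G"
proof -
  let ?t = "\<lambda>f g x y a b. f x a * g y b :: real"
  have V: "Val H = Sup {payoff H (?t f g) | f g. strategy (qX H) (ansA H) f \<and> strategy (qY H) (ansB H) g}"
    for H :: "('q, 'r, 'a, 'b) game"
    unfolding Val_def payoff_def by (simp add: mult.assoc)
  have "{payoff G' (?t f g) | f g. strategy (qX G') (ansA G') f \<and> strategy (qY G') (ansB G') g} =
    {payoff G (?t f g) | f g. strategy (qX G) (ansA G) f \<and> strategy (qY G) (ansB G) g}" (is "?L = ?R")
  proof
    show "?L \<subseteq> ?R"
    proof
      fix r assume "r \<in> ?L"
      then obtain f g where fg: "r = payoff G' (?t f g)" "strategy (qX G') (ansA G) f"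
        "strategy (qY G') (ansB G) g"
        unfolding ans by blast
      let ?f = "\<lambda>x a. (\<Sum>u\<in>fibX x. f u a) / real (card (fibX x))"
      let ?g = "\<lambda>y b. (\<Sum>v\<in>fibY y. g v b) / real (card (fibY y))"
      have "r = payoff G (?t ?f ?g)"
        unfolding fg(1) by (rule payoff_eqI) (simp add: sum_product)
      moreover have "strategy (qX G) (ansA G) ?f" "strategy (qY G) (ansB G) ?g"
        by (rule strategy_avg, fact, fact fib_subset, fact card_fib)+
      ultimately show "r \<in> ?R"
        by (intro CollectI exI[of _ ?f] exI[of _ ?g] conjI)
    qed
    show "?R \<subseteq> ?L"
    proof
      fix r assume "r \<in> ?R"
      then obtain f g where fg: "r = payoff G (?t f g)" "strategy (qX G) (ansA G) f"
        "strategy (qY G) (ansB G) g"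
        by blast
      have "r = payoff G' (?t (\<lambda>u. f (\<pi> u)) (\<lambda>v. g (\<rho> v)))"
        unfolding fg(1) using payoff_pullback[of "?t f g"] by simp
      then show "r \<in> ?L"
        using strategy_pullback[OF fg(2) proj(1)] strategy_pullback[OF fg(3) proj(2)] unfolding ans
        by (intro CollectI exI[of _ "\<lambda>u. f (\<pi> u)"] exI[of _ "\<lambda>v. g (\<rho> v)"] conjI)
    qed
  qed
  then show ?thesis
    unfolding V by simp
qed

text \<open>The dimension and the state are kept in both directions; only the measurements are
  averaged or copied.\<close>

lemma Val_star_eq: "Val_star G' = Val_star G"
proof -
  let ?t = "\<lambda>\<psi> P R x y a b. Re ((kron (P x a) (R y b) *\<^sub>v \<psi>) \<bullet>c \<psi>)"
  let ?ok = "\<lambda>X A Y B d \<psi> P R. \<psi> \<in> carrier_vec (d * d) \<and> \<psi> \<bullet>c \<psi> = 1 \<and> povms d X A P \<and> povms d Y B R"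
  have "{payoff G' (?t \<psi> P R) | d \<psi> P R. ?ok (qX G') (ansA G') (qY G') (ansB G') d \<psi> P R} =
    {payoff G (?t \<psi> P R) | d \<psi> P R. ?ok (qX G) (ansA G) (qY G) (ansB G) d \<psi> P R}" (is "?L = ?R")
  proof
    show "?L \<subseteq> ?R"
    proof
      fix r assume "r \<in> ?L"
      then obtain d \<psi> P R where fg: "r = payoff G' (?t \<psi> P R)"
        "\<psi> \<in> carrier_vec (d * d)" "\<psi> \<bullet>c \<psi> = 1" "povms d (qX G') (ansA G) P" "povms d (qY G') (ansB G) R"
        unfolding ans by blast
      let ?P = "\<lambda>x a. avg_mat d (fibX x) (\<lambda>u. P u a)"
      let ?R' = "\<lambda>y b. avg_mat d (fibY y) (\<lambda>v. R v b)"
      have "P u a \<in> carrier_mat d d" if "u \<in> fibX x" "a \<in> ansA G" for u a x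
        using subsetD[OF fib_subset(1) that(1)] that(2) fg(4) unfolding povms_def by blast
      moreover have "R v b \<in> carrier_mat d d" if "v \<in> fibY y" "b \<in> ansB G" for v b y
        using subsetD[OF fib_subset(2) that(1)] that(2) fg(5) unfolding povms_def by blast
      ultimately have "r = payoff G (?t \<psi> ?P ?R')"
        unfolding fg(1) using fg(2) by (intro payoff_eqI qform_kron_avg) simp_all
      moreover have "povms d (qX G) (ansA G) ?P" "povms d (qY G) (ansB G) ?R'"
        by (rule povms_avg, fact, fact fib_subset, fact card_fib)+
      ultimately show "r \<in> ?R"
        using fg(2,3) by (intro CollectI exI[of _ d] exI[of _ \<psi>] exI[of _ ?P] exI[of _ ?R'] conjI)
    qed
    show "?R \<subseteq> ?L"
    proof
      fix r assume "r \<in> ?R"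
      then obtain d \<psi> P R where fg: "r = payoff G (?t \<psi> P R)"
        "\<psi> \<in> carrier_vec (d * d)" "\<psi> \<bullet>c \<psi> = 1" "povms d (qX G) (ansA G) P" "povms d (qY G) (ansB G) R"
        by blast
      have "r = payoff G' (?t \<psi> (\<lambda>u. P (\<pi> u)) (\<lambda>v. R (\<rho> v)))"
        unfolding fg(1) using payoff_pullback[of "?t \<psi> P R"] by simp
      then show "r \<in> ?L"
        using fg(2,3) povms_pullback[OF fg(4) proj(1)] povms_pullback[OF fg(5) proj(2)] unfolding ans
        by (intro CollectI exI[of _ d] exI[of _ \<psi>] exI[of _ "\<lambda>u. P (\<pi> u)"]
            exI[of _ "\<lambda>v. R (\<rho> v)"] conjI)
    qed
  qed
  then show ?thesis
    unfolding Val_star_def payoff_def by simp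
qed

end

section \<open>The new game\<close>

lemma sum_fibre_card:
  assumes "finite S" "finite T" "h ` S \<subseteq> T"
  shows "(\<Sum>s\<in>S. g (h s)) = (\<Sum>t\<in>T. real (card {s \<in> S. h s = t}) * g t)"
proof -
  have "(\<Sum>s\<in>S. g (h s)) = (\<Sum>t\<in>T. \<Sum>s\<in>{s \<in> S. h s = t}. g (h s))"
    using assms by (rule sum.group[symmetric])
  also have "\<dots> = (\<Sum>t\<in>T. \<Sum>s\<in>{s \<in> S. h s = t}. g t)"
    by (intro sum.cong refl) simp
  finally show ?thesis
    by simp
qed

lemma take_drop_concat:
  "(\<And>l. l \<in> set ls \<Longrightarrow> length l = c) \<Longrightarrow> k < length ls \<Longrightarrow> take c (drop (k * c) (concat ls)) = ls ! k"
proof (induction ls arbitrary: k)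
  case (Cons l ls)
  then show ?case
    by (cases k) simp_all
qed simp

lemma concat_concat: "concat (concat xss) = concat (map concat xss)"
  by (induction xss) simp_all

lemma map_product:
  "map f (List.product xs ys) = concat (map (\<lambda>x. map (\<lambda>y. f (x, y)) ys) xs)"
  by (induction xs) simp_all

lemma map_via_nth: "map (\<lambda>k. f (l ! k)) [0..<length l] = map f l"
  by (rule nth_equalityI) simp_all

lemma length_concat_const:
  "(\<And>x. x \<in> set l \<Longrightarrow> length (f x) = c) \<Longrightarrow> length (concat (map f l)) = length l * c"
  by (induction l) simp_all

section \<open>Degrees and marginals in the bipartite graph\<close>

context tables
begin

lemma set_edges: "set edges = {(i, j). i < m \<and> j < n \<and> e i j}"
  by (auto simp: edges_def)

lemma distinct_edges: "distinct edges"
  unfolding edges_def by (intro distinct_filter distinct_product) simp_all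

lemma card_edges: "card {k. k < length edges \<and> P (edges ! k)} = card {p \<in> set edges. P p}"
  using distinct_card[OF distinct_filter[OF distinct_edges], of P]
  by (simp add: length_filter_conv_card)

text \<open>The edges with left end \<open>i\<close> are told apart by their right ends, which are
  the neighbours of \<open>i\<close>.\<close>

lemma card_fst_edges:
  assumes "i < m" shows "card {k. k < length edges \<and> fst (edges ! k) = i} = degX i"
proof -
  have "{p \<in> set edges. fst p = i} = Pair i ` {j \<in> {..<n}. e i j}"
    using assms by (auto simp: set_edges)
  moreover have "card {j \<in> {..<n}. e i j} = degX i"
    unfolding degX_def by (subst distinct_card[symmetric]) (auto intro: arg_cong[where f = card])
  ultimately show ?thesis
    using card_edges[of "\<lambda>p. fst p = i"] by (simp add: card_image inj_on_def)
qed

lemma card_snd_edges: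
  assumes "j < n" shows "card {k. k < length edges \<and> snd (edges ! k) = j} = degY j"
proof -
  have "{p \<in> set edges. snd p = j} = (\<lambda>i. (i, j)) ` {i \<in> {..<m}. e i j}"
    using assms by (auto simp: set_edges)
  moreover have "card {i \<in> {..<m}. e i j} = degY j"
    unfolding degY_def by (subst distinct_card[symmetric]) (auto intro: arg_cong[where f = card])
  ultimately show ?thesis
    using card_edges[of "\<lambda>p. snd p = j"] by (simp add: card_image inj_on_def)
qed

lemma nth_edges:
  assumes "k < length edges"
  shows "fst (edges ! k) < m" "snd (edges ! k) < n" "e (fst (edges ! k)) (snd (edges ! k))"
  using nth_mem[OF assms] unfolding set_edges by auto

lemma deg_pos:
  assumes "i < m" "j < n" "e i j" shows "0 < degX i" "0 < degY j"
  using assms by (auto simp: degX_def degY_def filter_empty_conv)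

lemma deg_edges_pos:
  assumes "k < length edges"
  shows "0 < degX (fst (edges ! k))" "0 < degY (snd (edges ! k))"
  using deg_pos[OF nth_edges[OF assms]] by simp_all

text \<open>The mass 1 / |E| of an edge, shared among the \<open>degX i * degY j\<close> pairs of
  copies of its ends.\<close>

definition prob :: "nat \<Rightarrow> nat \<Rightarrow> real" where
  "prob i j = of_bool (e i j) / real (length edges * degX i * degY j)"

text \<open>Grouped by right end, a neighbour \<open>j\<close> occurs \<open>degY j\<close> times,
  which cancels one degree; the number of neighbours cancels the other.\<close>

lemma sum_prob_snd:
  assumes "k < length edges"
  shows "(\<Sum>l<length edges. prob (fst (edges ! k)) (snd (edges ! l))) = 1 / real (length edges)"
proof -
  let ?i = "fst (edges ! k)"
  have i: "?i < m" "0 < degX ?i"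
    using nth_edges[OF assms] deg_pos by blast+
  have "(\<Sum>l<length edges. prob ?i (snd (edges ! l))) = (\<Sum>j<n. real (degY j) * prob ?i j)"
    by (subst sum_fibre_card[where T = "{..<n}"]) (auto simp: nth_edges card_snd_edges)
  also have "\<dots> = (\<Sum>j<n. of_bool (e ?i j) / real (length edges * degX ?i))"
  proof (intro sum.cong refl)
    \<comment> \<open>An adjacent \<open>j\<close> has positive degree and can be cancelled;
      otherwise both sides are zero.\<close>
    fix j assume "j \<in> {..<n}"
    then show "real (degY j) * prob ?i j = of_bool (e ?i j) / real (length edges * degX ?i)"
      by (cases "e ?i j") (use deg_pos(2)[OF i(1), of j] in \<open>auto simp: prob_def\<close>)
  qed
  also have "\<dots> = (\<Sum>j<n. of_bool (e ?i j)) / real (length edges * degX ?i)"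
    by (rule sum_divide_distrib[symmetric])
  also have "(\<Sum>j<n. of_bool (e ?i j)) = real (degX ?i)"
    unfolding degX_def by (subst distinct_card[symmetric]) (auto simp: of_bool_def sum.If_cases intro: arg_cong[where f = card])
  finally show ?thesis
    using i by simp
qed

lemma sum_prob_fst:
  assumes "l < length edges"
  shows "(\<Sum>k<length edges. prob (fst (edges ! k)) (snd (edges ! l))) = 1 / real (length edges)"
proof -
  let ?j = "snd (edges ! l)"
  have j: "?j < n" "0 < degY ?j"
    using nth_edges[OF assms] deg_pos by blast+
  have "(\<Sum>k<length edges. prob (fst (edges ! k)) ?j) = (\<Sum>i<m. real (degX i) * prob i ?j)"
    by (subst sum_fibre_card[where T = "{..<m}" and g = "\<lambda>i. prob i ?j"])
      (auto simp: nth_edges card_fst_edges)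
  also have "\<dots> = (\<Sum>i<m. of_bool (e i ?j) / real (length edges * degY ?j))"
  proof (intro sum.cong refl)
    fix i assume "i \<in> {..<m}"
    then show "real (degX i) * prob i ?j = of_bool (e i ?j) / real (length edges * degY ?j)"
      by (cases "e i ?j") (use deg_pos(1)[OF _ j(1), of i] in \<open>auto simp: prob_def\<close>)
  qed
  also have "\<dots> = (\<Sum>i<m. of_bool (e i ?j)) / real (length edges * degY ?j)"
    by (rule sum_divide_distrib[symmetric])
  also have "(\<Sum>i<m. of_bool (e i ?j)) = real (degY ?j)"
    unfolding degY_def by (subst distinct_card[symmetric]) (auto simp: of_bool_def sum.If_cases intro: arg_cong[where f = card])
  finally show ?thesis
    using j by simp
qed

end

text \<open>Names the listings and fractions that \<open>encodes\<close> quantifies existentially,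
  so that questions can be replaced by their positions.\<close>

locale listed_game =
  fixes G :: "('x, 'y, 'a, 'b) game" and E :: "('x \<times> 'y) set"
    and xs :: "'x list" and ys :: "'y list" and as :: "'a list" and bs :: "'b list"
    and p q :: "'x \<Rightarrow> 'y \<Rightarrow> nat"
  assumes game: "is_game G" and graphical: "graphical G E" and E: "E \<noteq> {}"
    and distinct: "distinct xs" "distinct ys" "distinct as" "distinct bs"
    and sets: "set xs = qX G" "set ys = qY G" "set as = ansA G" "set bs = ansB G"
    and frac: "\<And>x y. x \<in> qX G \<Longrightarrow> y \<in> qY G \<Longrightarrow> 0 < q x y \<and> mu G x y = real (p x y) / real (q x y)"
begin

definition fracs :: "(nat \<times> nat) list" where
  "fracs = map (\<lambda>(x, y). (p x y, q x y)) (List.product xs ys)"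

definition wins :: "'x \<Rightarrow> 'y \<Rightarrow> bool list" where
  "wins x y = concat (map (\<lambda>a. map (\<lambda>b. win G a b x y) bs) as)"

definition preds :: "bool list" where
  "preds = concat (map (\<lambda>(x, y). wins x y) (List.product xs ys))"

definition code :: "bool list" where
  "code = tally (length xs) @ tally (length ys) @ tally (length as) @ tally (length bs) @
     concat (map enc_frac fracs) @ preds"

definition adj :: "nat \<Rightarrow> nat \<Rightarrow> bool" where
  "adj i j \<longleftrightarrow> (xs ! i, ys ! j) \<in> E"

lemma finite_E: "finite E" "E \<subseteq> qX G \<times> qY G"
proof -
  show "E \<subseteq> qX G \<times> qY G"
    using graphical unfolding graphical_def by blast
  then show "finite E"
    by (rule finite_subset) (use game in \<open>simp add: is_game_def\<close>)
qed

lemma mu_eq: "x \<in> qX G \<Longrightarrow> y \<in> qY G \<Longrightarrow> mu G x y = of_bool ((x, y) \<in> E) / real (card E)"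
  using graphical unfolding graphical_def by simp

text \<open>Links what the program sees, a nonzero numerator, to membership in \<open>E\<close>; the
  representation of the fraction is irrelevant to it.\<close>

lemma p_eq_0_iff:
  assumes "x \<in> qX G" "y \<in> qY G" shows "p x y = 0 \<longleftrightarrow> (x, y) \<notin> E"
proof -
  have "card E > 0"
    using finite_E E by (simp add: card_gt_0_iff)
  then have "mu G x y = 0 \<longleftrightarrow> (x, y) \<notin> E"
    using mu_eq[OF assms] by simp
  moreover have "mu G x y = 0 \<longleftrightarrow> p x y = 0"
    using frac[OF assms] by simp
  ultimately show ?thesis
    by simp
qed

lemma length_wins: "length (wins x y) = length as * length bs"
  unfolding wins_def by (rule length_concat_const) simp

lemma product_nth_index:
  assumes "i < length xs" "j < length ys"
  shows "List.product xs ys ! (i * length ys + j) = (xs ! i, ys ! j)"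
proof -
  have "ys \<noteq> []"
    using assms by auto
  then have "(i * length ys + j) div length ys = i" "(i * length ys + j) mod length ys = j"
    using assms by simp_all
  then show ?thesis
    using product_nth[OF index_less[OF assms]] by simp
qed

lemma length_preds: "length preds = length xs * length ys * (length as * length bs)"
  unfolding preds_def by (subst length_concat_const) (auto simp: length_wins)

text \<open>Taking the input length for \<open>Z\<close> makes the cost a function of that length
  alone.\<close>

sublocale tables "length xs" "length ys" "length as" "length bs" "map (\<lambda>(p, _). p \<noteq> 0) fracs" preds adj
  "length code"
proof
  fix i j assume ij: "i < length xs" "j < length ys"
  then have "xs ! i \<in> qX G" "ys ! j \<in> qY G"
    using sets nth_mem by blast+
  then show "map (\<lambda>(p, _). p \<noteq> 0) fracs ! (i * length ys + j) = adj i j"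
    using index_less[OF ij] product_nth_index[OF ij] p_eq_0_iff[of "xs ! i" "ys ! j"] by (auto simp: fracs_def adj_def)
next
  \<comment> \<open>Every fraction occupies at least one bit, so the input is at least as long as
    the table has entries.\<close>
  have "length l \<le> length (concat (map enc_frac l))" for l
    by (induction l) (auto simp: enc_frac_def enc_nat_def)
  from this[of fracs] show "length xs * length ys \<le> length code"
    by (simp add: code_def fracs_def)
qed (simp_all add: fracs_def length_preds code_def tally_def)

definition projX :: "nat \<Rightarrow> 'x" where
  "projX k = xs ! fst (edges ! k)"

definition projY :: "nat \<Rightarrow> 'y" where
  "projY k = ys ! snd (edges ! k)"

definition blown :: "(nat, nat, 'a, 'b) game" where
  "blown = \<lparr>qX = {..<length edges}, qY = {..<length edges}, ansA = ansA G, ansB = ansB G,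
     mu = \<lambda>k l. prob (fst (edges ! k)) (snd (edges ! l)),
     win = \<lambda>a b k l. win G a b (projX k) (projY l)\<rparr>"

lemma proj_in: "k < length edges \<Longrightarrow> projX k \<in> qX G" "k < length edges \<Longrightarrow> projY k \<in> qY G"
  using nth_edges[of k] sets unfolding projX_def projY_def by (metis nth_mem)+

lemma edge_obtain:
  assumes "(x, y) \<in> E"
  obtains k where "k < length edges" "projX k = x" "projY k = y"
proof -
  have "x \<in> set xs" "y \<in> set ys"
    using assms finite_E(2) sets by blast+
  then obtain i j where ij: "i < length xs" "xs ! i = x" "j < length ys" "ys ! j = y"
    by (metis in_set_conv_nth)
  then have "(i, j) \<in> set edges"
    using assms by (simp add: set_edges adj_def)
  then obtain k where "k < length edges" "edges ! k = (i, j)"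
    by (auto simp: in_set_conv_nth)
  then show thesis
    using ij that by (simp add: projX_def projY_def)
qed

text \<open>Distinct listings make positions faithful, so the listed edges run through
  \<open>E\<close> without repetition.\<close>

lemma length_edges: "length edges = card E"
proof -
  have "bij_betw (\<lambda>k. (projX k, projY k)) {..<length edges} E"
    unfolding bij_betw_def
  proof
    show "inj_on (\<lambda>k. (projX k, projY k)) {..<length edges}"
    proof (rule inj_onI)
      fix k l assume kl: "k \<in> {..<length edges}" "l \<in> {..<length edges}"
        "(projX k, projY k) = (projX l, projY l)"
      then have "edges ! k = edges ! l"
        using nth_edges[of k] nth_edges[of l] distinct
        by (auto simp: projX_def projY_def nth_eq_iff_index_eq prod_eq_iff)
      then show "k = l"
        using kl distinct_edges by (simp add: nth_eq_iff_index_eq)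
    qed
    show "(\<lambda>k. (projX k, projY k)) ` {..<length edges} = E"
    proof
      show "(\<lambda>k. (projX k, projY k)) ` {..<length edges} \<subseteq> E"
        using nth_edges(3) by (auto simp: projX_def projY_def adj_def)
      show "E \<subseteq> (\<lambda>k. (projX k, projY k)) ` {..<length edges}"
        by (auto elim!: edge_obtain)
    qed
  qed
  then show ?thesis
    using bij_betw_same_card by fastforce
qed

lemma length_edges_pos: "0 < length edges"
  using finite_E E by (simp add: length_edges card_gt_0_iff)

lemma is_game_blown: "is_game blown"
  using game length_edges_pos
  by (auto simp: is_game_def blown_def sum_prob_snd) (simp add: prob_def)

lemma biregular_blown: "biregular blown"
  by (simp add: biregular_def blown_def sum_prob_snd sum_prob_fst)

text \<open>The fibres of \<open>projX\<close> and \<open>projY\<close> are the edges sharing a left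
  or right end, so dividing \<open>mu G\<close> by the fibre sizes gives exactly
  \<open>prob\<close>.\<close>

sublocale blowup G blown projX projY
proof
  fix k l assume "k \<in> qX blown" "l \<in> qY blown"
  then have kl: "k < length edges" "l < length edges"
    by (simp_all add: blown_def)
  have "{k' \<in> qX blown. projX k' = projX k} = {k'. k' < length edges \<and> fst (edges ! k') = fst (edges ! k)}"
    using nth_edges(1) kl distinct by (auto simp: blown_def projX_def nth_eq_iff_index_eq)
  moreover have "{l' \<in> qY blown. projY l' = projY l} = {l'. l' < length edges \<and> snd (edges ! l') = snd (edges ! l)}"
    using nth_edges(2) kl distinct by (auto simp: blown_def projY_def nth_eq_iff_index_eq)
  ultimately show "mu blown k l = mu G (projX k) (projY l) /
     (real (card {u' \<in> qX blown. projX u' = projX k}) * real (card {v' \<in> qY blown. projY v' = projY l}))"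
    using kl nth_edges(1,2)
    by (simp add: card_fst_edges card_snd_edges mu_eq proj_in length_edges[symmetric])
      (simp add: blown_def prob_def adj_def projX_def projY_def mult.assoc)
next
  fix x y assume "x \<in> qX G" "y \<in> qY G" "mu G x y \<noteq> 0"
  then have "(x, y) \<in> E"
    by (simp add: mu_eq)
  then show "x \<in> projX ` qX blown \<and> y \<in> projY ` qY blown"
    by (elim edge_obtain) (auto simp: blown_def)
qed (use game length_edges_pos in \<open>auto simp: is_game_def blown_def proj_in\<close>)

lemma block_eq:
  assumes "i < length xs" "j < length ys"
  shows "block i j = wins (xs ! i) (ys ! j)"
  unfolding block_def unfolding preds_def
  by (subst take_drop_concat) (use index_less[OF assms] product_nth_index[OF assms] in \<open>auto simp: length_wins\<close>)

lemma code_comprehension: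
  "code = tally (length xs) @ tally (length ys) @ tally (length as) @ tally (length bs) @
         concat [enc_nat (p x y) @ enc_nat (q x y). x \<leftarrow> xs, y \<leftarrow> ys] @
         [win G a b x y. x \<leftarrow> xs, y \<leftarrow> ys, a \<leftarrow> as, b \<leftarrow> bs]"
proof -
  have "map enc_frac fracs = [enc_nat (p x y) @ enc_nat (q x y). x \<leftarrow> xs, y \<leftarrow> ys]"
    by (simp add: fracs_def map_product map_concat enc_frac_def comp_def)
  moreover have "preds = [win G a b x y. x \<leftarrow> xs, y \<leftarrow> ys, a \<leftarrow> as, b \<leftarrow> bs]"
    unfolding preds_def map_product by (simp add: concat_concat wins_def comp_def)
  ultimately show ?thesis
    unfolding code_def by simp
qed

lemma encodes_blown: "encodes result blown"
proof -
  let ?K = "length edges"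
  let ?p = "\<lambda>k l. of_bool (adj (fst (edges ! k)) (snd (edges ! l))) :: nat"
  let ?q = "\<lambda>k l. ?K * degX (fst (edges ! k)) * degY (snd (edges ! l))"
  let ?ks = "[0..<?K]"
  have inner: "concat (map (\<lambda>l. f i (snd (edges ! l))) ?ks) = concat (map (\<lambda>(_, j). f i j) edges)"
    for f :: "nat \<Rightarrow> nat \<Rightarrow> bool list" and i
    using map_via_nth[of "\<lambda>e. f i (snd e)" edges] by (simp add: split_def)
  \<comment> \<open>The program loops over edges, \<open>encodes\<close> over questions; the new
    questions are edge numbers, so looking edges up by number matches the two.\<close>
  have pairs: "concat (map (\<lambda>(i, _). concat (map (\<lambda>(_, j). f i j) edges)) edges) =
      concat (map (\<lambda>k. concat (map (\<lambda>l. f (fst (edges ! k)) (snd (edges ! l))) ?ks)) ?ks)"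
    for f :: "nat \<Rightarrow> nat \<Rightarrow> bool list"
    unfolding inner
    using map_via_nth[of "\<lambda>e. concat (map (\<lambda>(_, j). f (fst e) j) edges)" edges]
    by (simp add: split_def)
  have entries: "concat (map (\<lambda>(i, _). concat (map (\<lambda>(_, j). entry i j) edges)) edges) =
      concat [enc_nat (?p k l) @ enc_nat (?q k l). k \<leftarrow> ?ks, l \<leftarrow> ?ks]"
    unfolding pairs by (simp add: entry_def concat_concat comp_def)
  have "block (fst (edges ! k)) (snd (edges ! l)) = wins (projX k) (projY l)"
    if "k < ?K" "l < ?K" for k l
    using that by (simp add: block_eq nth_edges projX_def projY_def)
  then have "concat (map (\<lambda>(i, _). concat (map (\<lambda>(_, j). block i j) edges)) edges) =
      concat (map (\<lambda>k. concat (map (\<lambda>l. wins (projX k) (projY l)) ?ks)) ?ks)"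
    unfolding pairs by (intro arg_cong[where f = concat] map_cong) simp_all
  then have blocks: "concat (map (\<lambda>(i, _). concat (map (\<lambda>(_, j). block i j) edges)) edges) =
      [win blown a b k l. k \<leftarrow> ?ks, l \<leftarrow> ?ks, a \<leftarrow> as, b \<leftarrow> bs]"
    by (simp add: wins_def blown_def)
  show ?thesis
    unfolding encodes_def
  proof (intro exI conjI)
    \<comment> \<open>The denominator is positive even at probability zero, since each degree
      belongs to an end of some edge.\<close>
    show "\<forall>k\<in>qX blown. \<forall>l\<in>qY blown. 0 < ?q k l \<and> mu blown k l = real (?p k l) / real (?q k l)"
      using length_edges_pos deg_edges_pos by (auto simp: blown_def prob_def)
    show "result = tally (length ?ks) @ tally (length ?ks) @ tally (length as) @ tally (length bs) @
         concat [enc_nat (?p k l) @ enc_nat (?q k l). k \<leftarrow> ?ks, l \<leftarrow> ?ks] @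
         [win blown a b k l. k \<leftarrow> ?ks, l \<leftarrow> ?ks, a \<leftarrow> as, b \<leftarrow> bs]"
      unfolding result_def entries blocks by simp
  qed (use distinct sets in \<open>auto simp: blown_def\<close>)
qed

lemma computes_code: "\<exists>t\<le>total_cost (length code). computes Program code t result"
  by (rule computes_Program[where ps = fracs, OF _ refl code_def order.refl]) (simp add: fracs_def)

end

theorem lemma2p10:
  shows "\<exists>(c :: com) (p :: nat poly).
    \<forall>(G :: (nat, nat, nat, nat) game) (E :: (nat \<times> nat) set) (w :: bool list).
      is_game G \<and> graphical G E \<and> E \<noteq> {} \<and> encodes w G \<longrightarrow>
      (\<exists>(t :: nat) (w' :: bool list) (G' :: (nat, nat, nat, nat) game).
         computes c w t w' \<and> t \<le> poly p (length w) \<and> encodes w' G' \<and>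
         is_game G' \<and> biregular G' \<and>
         card (qX G') \<le> card E * card (qX G) \<and>
         card E * card (qX G) \<le> card (qX G) ^ 2 * card (qY G) \<and>
         card (qY G') \<le> card E * card (qY G) \<and>
         card E * card (qY G) \<le> card (qX G) * card (qY G) ^ 2 \<and>
         card (ansA G') = card (ansA G) \<and> card (ansB G') = card (ansB G) \<and>
         Val G = Val G' \<and> Val_star G = Val_star G')"
proof -
  obtain P where P: "\<And>n. total_cost n = poly P n"
    using is_poly_total_cost unfolding is_poly_def by blast
  show ?thesis
  proof (intro exI[of _ Program] exI[of _ P] allI impI, elim conjE)
    fix G :: "(nat, nat, nat, nat) game" and E w
    assume G: "is_game G" "graphical G E" "E \<noteq> {}" "encodes w G"
    from G(4) obtain xs ys as bs p q where l: "distinct xs" "set xs = qX G" "distinct ys" "set ys = qY G"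
      "distinct as" "set as = ansA G" "distinct bs" "set bs = ansB G"
      "\<forall>x\<in>qX G. \<forall>y\<in>qY G. 0 < q x y \<and> mu G x y = real (p x y) / real (q x y)"
      and w: "w = tally (length xs) @ tally (length ys) @ tally (length as) @ tally (length bs) @
         concat [enc_nat (p x y) @ enc_nat (q x y). x \<leftarrow> xs, y \<leftarrow> ys] @
         [win G a b x y. x \<leftarrow> xs, y \<leftarrow> ys, a \<leftarrow> as, b \<leftarrow> bs]"
      unfolding encodes_def by blast
    interpret listed_game G E xs ys as bs p q
      using G l by unfold_locales auto
    have "w = code"
      using w code_comprehension by simp
    then obtain t where t: "computes Program w t result" "t \<le> poly P (length w)"
      using computes_code P by metis
    have "card E \<le> card (qX G) * card (qY G)"
      using card_mono[OF _ finite_E(2)] fin by (simp add: card_cartesian_product)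
    then have "card E * card (qX G) \<le> card (qX G) ^ 2 * card (qY G)"
      "card E * card (qY G) \<le> card (qX G) * card (qY G) ^ 2"
      using mult_le_mono1[of "card E" "card (qX G) * card (qY G)"]
      by (simp_all add: power2_eq_square ac_simps)
    \<comment> \<open>Each new question set has exactly \<open>card E\<close> elements, so a
      nonempty old question set gives the claimed bound.\<close>
    moreover have "qX G \<noteq> {}" "qY G \<noteq> {}"
      using finite_E(2) E by auto
    then have "card (qX blown) \<le> card E * card (qX G)" "card (qY blown) \<le> card E * card (qY G)"
      using fin by (simp_all add: blown_def length_edges card_gt_0_iff Suc_le_eq)
    moreover have "card (ansA blown) = card (ansA G)" "card (ansB blown) = card (ansB G)"
      by (simp_all add: blown_def)
    ultimately show "\<exists>t w' G'. computes Program w t w' \<and> t \<le> poly P (length w) \<and> encodes w' G' \<and>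
         is_game G' \<and> biregular G' \<and>
         card (qX G') \<le> card E * card (qX G) \<and>
         card E * card (qX G) \<le> card (qX G) ^ 2 * card (qY G) \<and>
         card (qY G') \<le> card E * card (qY G) \<and>
         card E * card (qY G) \<le> card (qX G) * card (qY G) ^ 2 \<and>
         card (ansA G') = card (ansA G) \<and> card (ansB G') = card (ansB G) \<and>
         Val G = Val G' \<and> Val_star G = Val_star (G' :: (nat, nat, nat, nat) game)"
      using t encodes_blown is_game_blown biregular_blown Val_eq Val_star_eq
      by (intro exI[of _ t] exI[of _ result] exI[of _ blown]) simp
  qed
qed

end
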